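(* For all $x,y,x',y'\in M$, $$\langle\langle x,y\rangle\rangle=\langle\langle x',y'\rangle\rangle \iff x=x' \text{ and } y=y'.$$
   Context: Work in ZFA, i.e. ZF with a set $A$ of atoms. Fix a preorder $\preccurlyeq$ on $A$ with no minimal elements: for every $a\in A$ there is $b\in A$ with $b\preccurlyeq a$ and $a\not\preccurlyeq b$. For $a\in A$ let $pr(a)=\{b\in A:b\preccurlyeq a\}$. Define the magmatic hierarchy: $M_1$ is the set of nonempty subsets $x\subseteq A$ that are downward closed ($a\in x$ and $b\preccurlyeq a$ imply $b\in x$); for $\alpha\geq 1$, $M_{\alpha+1}$ is the set of nonempty $x\subseteq M_\alpha$ such that for every $y\in x$, every $z\in M_\alpha$ with $z\subseteq y$ belongs to $x$; $M_\lambda=\bigcup_{1\leq\beta<\lambda}M_\beta$ for limit $\lambda$; $M=\bigcup_{\alpha\geq1}M_\alpha$. For $x\in M$ let $pr(x)=\{y\in M:y\subseteq x\}$, and $pr^2=pr\circ pr$. Fix two atoms $a_0,a_1\in A$ incomparable under $\preccurlyeq$ ($a_0\not\preccurlyeq a_1$ and $a_1\not\preccurlyeq a_0$). For $x,y\in M$ the magmatic pair is $\langle\langle x,y\rangle\rangle:=pr(pr^2(x)\cup pr^2(a_0))\cup pr(pr^2(y)\cup pr^2(a_1))$. *)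

theory Defs
  imports Main
begin

text \<open>
  Set theory with atoms, ZFA, is rendered as the class of all its first-order models: the type is
  the universe of the model. Separation and Replacement range only over first-order formulas with
  parameters, so that no second-order comprehension is assumed of the model. Formulas use
  de Bruijn indices; the constants for the empty set and for the set of atoms may enter a formula
  as parameters and therefore need no syntax of their own.
\<close>

datatype fm = Member nat nat | Equal nat nat | Neg fm | And fm fm | Exists fm

primrec sat :: "('v \<Rightarrow> 'v \<Rightarrow> bool) \<Rightarrow> (nat \<Rightarrow> 'v) \<Rightarrow> fm \<Rightarrow> bool" where
  "sat E e (Member i j) \<longleftrightarrow> E (e i) (e j)"
| "sat E e (Equal i j) \<longleftrightarrow> e i = e j"
| "sat E e (Neg p) \<longleftrightarrow> \<not> sat E e p"
| "sat E e (And p q) \<longleftrightarrow> sat E e p \<and> sat E e q"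
| "sat E e (Exists p) \<longleftrightarrow> (\<exists>x. sat E (case_nat x e) p)"

class zfa =
  fixes mem :: "'a \<Rightarrow> 'a \<Rightarrow> bool"  (infix \<open>\<^bold>\<in>\<close> 50)
    and nul :: 'a
    and atoms :: 'a
  assumes empty_set: "\<not> x \<^bold>\<in> nul"
    and atoms: "z \<^bold>\<in> atoms \<longleftrightarrow> z \<noteq> nul \<and> (\<nexists>x. x \<^bold>\<in> z)"
    and extensionality:
      "\<not> x \<^bold>\<in> atoms \<Longrightarrow> \<not> y \<^bold>\<in> atoms \<Longrightarrow> (\<forall>z. z \<^bold>\<in> x \<longleftrightarrow> z \<^bold>\<in> y) \<Longrightarrow> x = y"
    and foundation: "\<exists>x. x \<^bold>\<in> s \<Longrightarrow> \<exists>x. x \<^bold>\<in> s \<and> \<not> (\<exists>z. z \<^bold>\<in> x \<and> z \<^bold>\<in> s)"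
    and pairing: "\<exists>p. \<forall>z. z \<^bold>\<in> p \<longleftrightarrow> z = x \<or> z = y"
    and union: "\<exists>v. \<forall>z. z \<^bold>\<in> v \<longleftrightarrow> (\<exists>y. z \<^bold>\<in> y \<and> y \<^bold>\<in> u)"
    and powerset:
      "\<exists>v. \<forall>y. y \<^bold>\<in> v \<longleftrightarrow> \<not> y \<^bold>\<in> atoms \<and> (\<forall>z. z \<^bold>\<in> y \<longrightarrow> z \<^bold>\<in> u)"
    and infinity:
      "\<exists>s. nul \<^bold>\<in> s \<and>
         (\<forall>x. x \<^bold>\<in> s \<longrightarrow> (\<exists>y. y \<^bold>\<in> s \<and> (\<forall>z. z \<^bold>\<in> y \<longleftrightarrow> z \<^bold>\<in> x \<or> z = x)))"
    and separation:
      "\<exists>v. \<forall>x. x \<^bold>\<in> v \<longleftrightarrow> x \<^bold>\<in> u \<and> sat (\<^bold>\<in>) (case_nat x e) p"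
    and replacement:
      "(\<And>x y z. x \<^bold>\<in> u \<Longrightarrow> sat (\<^bold>\<in>) (case_nat x (case_nat y e)) p \<Longrightarrow>
          sat (\<^bold>\<in>) (case_nat x (case_nat z e)) p \<Longrightarrow> y = z) \<Longrightarrow>
       \<exists>v. \<forall>y. y \<^bold>\<in> v \<longleftrightarrow> (\<exists>x. x \<^bold>\<in> u \<and> sat (\<^bold>\<in>) (case_nat x (case_nat y e)) p)"

definition is_set :: "'v::zfa \<Rightarrow> bool" where
  "is_set x \<longleftrightarrow> \<not> x \<^bold>\<in> atoms"

definition subset_of :: "'v::zfa \<Rightarrow> 'v \<Rightarrow> bool"  (infix \<open>\<^bold>\<subseteq>\<close> 50) where
  "x \<^bold>\<subseteq> y \<longleftrightarrow> is_set x \<and> is_set y \<and> (\<forall>z. z \<^bold>\<in> x \<longrightarrow> z \<^bold>\<in> y)"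

text \<open>The set of the model whose elements are those satisfying \<open>P\<close>, when there is one.\<close>

definition the_set :: "('v::zfa \<Rightarrow> bool) \<Rightarrow> 'v" where
  "the_set P = (THE v. is_set v \<and> (\<forall>z. z \<^bold>\<in> v \<longleftrightarrow> P z))"

definition upair :: "'v::zfa \<Rightarrow> 'v \<Rightarrow> 'v" where
  "upair x y = the_set (\<lambda>z. z = x \<or> z = y)"

definition kpair :: "'v::zfa \<Rightarrow> 'v \<Rightarrow> 'v" where
  "kpair x y = upair (upair x x) (upair x y)"

definition un :: "'v::zfa \<Rightarrow> 'v \<Rightarrow> 'v"  (infixl \<open>\<^bold>\<union>\<close> 65) where
  "x \<^bold>\<union> y = the_set (\<lambda>z. z \<^bold>\<in> x \<or> z \<^bold>\<in> y)"

definition osucc :: "'v::zfa \<Rightarrow> 'v" where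
  "osucc x = the_set (\<lambda>z. z \<^bold>\<in> x \<or> z = x)"

text \<open>Von Neumann ordinals of the model; the elements of an ordinal are required to be sets
  because an atom is vacuously transitive.\<close>

definition transitive_set :: "'v::zfa \<Rightarrow> bool" where
  "transitive_set x \<longleftrightarrow> is_set x \<and> (\<forall>y z. y \<^bold>\<in> x \<longrightarrow> z \<^bold>\<in> y \<longrightarrow> z \<^bold>\<in> x)"

definition ordinal :: "'v::zfa \<Rightarrow> bool" where
  "ordinal \<alpha> \<longleftrightarrow> transitive_set \<alpha> \<and> (\<forall>\<beta>. \<beta> \<^bold>\<in> \<alpha> \<longrightarrow> transitive_set \<beta>)"

definition limit_ordinal :: "'v::zfa \<Rightarrow> bool" where
  "limit_ordinal \<alpha> \<longleftrightarrow> ordinal \<alpha> \<and> \<alpha> \<noteq> nul \<and> (\<forall>\<beta>. \<beta> \<^bold>\<in> \<alpha> \<longrightarrow> osucc \<beta> \<^bold>\<in> \<alpha>)"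

definition atom_le :: "'v::zfa \<Rightarrow> 'v \<Rightarrow> 'v \<Rightarrow> bool" where
  "atom_le R b a \<longleftrightarrow> kpair b a \<^bold>\<in> R"

definition preorder_on_atoms :: "'v::zfa \<Rightarrow> bool" where
  "preorder_on_atoms R \<longleftrightarrow>
     is_set R \<and>
     (\<forall>p. p \<^bold>\<in> R \<longrightarrow> (\<exists>a b. a \<^bold>\<in> atoms \<and> b \<^bold>\<in> atoms \<and> p = kpair a b)) \<and>
     (\<forall>a. a \<^bold>\<in> atoms \<longrightarrow> atom_le R a a) \<and>
     (\<forall>a b c. atom_le R a b \<longrightarrow> atom_le R b c \<longrightarrow> atom_le R a c)"

definition no_minimal_atoms :: "'v::zfa \<Rightarrow> bool" where
  "no_minimal_atoms R \<longleftrightarrow>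
     (\<forall>a. a \<^bold>\<in> atoms \<longrightarrow> (\<exists>b. b \<^bold>\<in> atoms \<and> atom_le R b a \<and> \<not> atom_le R a b))"

definition magma_base :: "'v::zfa \<Rightarrow> 'v" where
  "magma_base R = the_set (\<lambda>x. x \<^bold>\<subseteq> atoms \<and> x \<noteq> nul \<and>
     (\<forall>a b. a \<^bold>\<in> x \<longrightarrow> b \<^bold>\<in> atoms \<longrightarrow> atom_le R b a \<longrightarrow> b \<^bold>\<in> x))"

definition magma_next :: "'v::zfa \<Rightarrow> 'v" where
  "magma_next m = the_set (\<lambda>x. x \<^bold>\<subseteq> m \<and> x \<noteq> nul \<and>
     (\<forall>y z. y \<^bold>\<in> x \<longrightarrow> z \<^bold>\<in> m \<longrightarrow> z \<^bold>\<subseteq> y \<longrightarrow> z \<^bold>\<in> x))"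

definition app :: "'v::zfa \<Rightarrow> 'v \<Rightarrow> 'v" where
  "app f x = (THE y. kpair x y \<^bold>\<in> f)"

text \<open>\<open>magma_seq R \<alpha> f\<close>: inside the model, \<open>f\<close> is the function with domain the ordinals
  \<open>1 \<le> \<beta> \<le> \<alpha>\<close> that obeys the recursion of the magmatic hierarchy.\<close>

definition magma_seq :: "'v::zfa \<Rightarrow> 'v \<Rightarrow> 'v \<Rightarrow> bool" where
  "magma_seq R \<alpha> f \<longleftrightarrow>
     is_set f \<and>
     (\<forall>p. p \<^bold>\<in> f \<longrightarrow> (\<exists>\<beta> m. \<beta> \<^bold>\<in> osucc \<alpha> \<and> \<beta> \<noteq> nul \<and> p = kpair \<beta> m)) \<and>
     (\<forall>\<beta>. \<beta> \<^bold>\<in> osucc \<alpha> \<and> \<beta> \<noteq> nul \<longrightarrow> (\<exists>!m. kpair \<beta> m \<^bold>\<in> f)) \<and>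
     (osucc nul \<^bold>\<in> osucc \<alpha> \<longrightarrow> app f (osucc nul) = magma_base R) \<and>
     (\<forall>\<beta>. \<beta> \<noteq> nul \<and> osucc \<beta> \<^bold>\<in> osucc \<alpha> \<longrightarrow> app f (osucc \<beta>) = magma_next (app f \<beta>)) \<and>
     (\<forall>\<gamma>. limit_ordinal \<gamma> \<and> \<gamma> \<^bold>\<in> osucc \<alpha> \<longrightarrow>
        app f \<gamma> = the_set (\<lambda>x. \<exists>\<beta>. \<beta> \<^bold>\<in> \<gamma> \<and> \<beta> \<noteq> nul \<and> x \<^bold>\<in> app f \<beta>))"

definition magma_level :: "'v::zfa \<Rightarrow> 'v \<Rightarrow> 'v" where
  "magma_level R \<alpha> = app (THE f. magma_seq R \<alpha> f) \<alpha>"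

text \<open>The hierarchy is a proper class of the model, hence a HOL set.\<close>

definition magmas :: "'v::zfa \<Rightarrow> 'v set" where
  "magmas R = {x. \<exists>\<alpha>. ordinal \<alpha> \<and> \<alpha> \<noteq> nul \<and> x \<^bold>\<in> magma_level R \<alpha>}"

definition pr :: "'v::zfa \<Rightarrow> 'v \<Rightarrow> 'v" where
  "pr R x =
     (if x \<^bold>\<in> atoms then the_set (\<lambda>b. b \<^bold>\<in> atoms \<and> atom_le R b x)
      else the_set (\<lambda>y. y \<in> magmas R \<and> y \<^bold>\<subseteq> x))"

definition magma_pair :: "'v::zfa \<Rightarrow> 'v \<Rightarrow> 'v \<Rightarrow> 'v \<Rightarrow> 'v \<Rightarrow> 'v" where
  "magma_pair R a0 a1 x y =
     pr R (pr R (pr R x) \<^bold>\<union> pr R (pr R a0)) \<^bold>\<union> pr R (pr R (pr R y) \<^bold>\<union> pr R (pr R a1))"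

end

theory Submission
  imports Defs
begin

text \<open>
  A nonempty set of magmas that is closed under passing to submagmas is itself a magma: by
  Replacement some limit level \<open>\<gamma>\<close> contains all its elements, and the set then lies in level \<open>\<gamma>+1\<close>.
  In particular \<open>U(x,a) = pr(pr(x)) \<union> pr(pr(a))\<close>, called \<open>magma_tag R a x\<close> below, is a magma,
  although it mixes levels, and hence an element of \<open>pr(U(x,a))\<close>. Equality of two pairs therefore
  makes \<open>U(x,a0)\<close> a subset of \<open>U(x',a0)\<close> or of \<open>U(y',a1)\<close>. The second is impossible, since
  \<open>pr(a0)\<close> contains the atom \<open>a0\<close>, which is neither a magma nor below \<open>a1\<close>. In the first, \<open>pr(x)\<close>
  contains no atoms and so lies in \<open>pr(pr(x'))\<close>, which gives \<open>x \<subseteq> x'\<close>.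

  Separation and Replacement hold only for first-order formulas, so transfinite induction and
  recursion are available only for definable classes; closure properties of definability with
  parameters replace explicit formulas.
\<close>

section \<open>Definability with parameters\<close>

primrec rename :: "(nat \<Rightarrow> nat) \<Rightarrow> fm \<Rightarrow> fm" where
  "rename f (Member i j) = Member (f i) (f j)"
| "rename f (Equal i j) = Equal (f i) (f j)"
| "rename f (Neg p) = Neg (rename f p)"
| "rename f (And p q) = And (rename f p) (rename f q)"
| "rename f (Exists p) = Exists (rename (case_nat 0 (\<lambda>i. Suc (f i))) p)"

lemma sat_rename: "sat E e (rename f p) \<longleftrightarrow> sat E (\<lambda>i. e (f i)) p"
proof (induction p arbitrary: e f)
  case (Exists p)
  have "(\<lambda>i. case_nat x e (case_nat 0 (\<lambda>i. Suc (f i)) i)) = case_nat x (\<lambda>i. e (f i))" for x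
    by (auto simp: fun_eq_iff split: nat.split)
  then show ?case by (simp add: Exists.IH)
qed auto

text \<open>A variable \<open>i\<close> of a formula stands for the argument \<open>j\<close> if \<open>s i = Inl j\<close>, and for the
  parameter \<open>c\<close> if \<open>s i = Inr c\<close>.\<close>

definition assign :: "(nat \<Rightarrow> nat + 'v) \<Rightarrow> (nat \<Rightarrow> 'v) \<Rightarrow> nat \<Rightarrow> 'v" where
  "assign s e i = case_sum e (\<lambda>c. c) (s i)"

definition definable :: "((nat \<Rightarrow> 'v::zfa) \<Rightarrow> bool) \<Rightarrow> bool" where
  "definable Q \<longleftrightarrow> (\<exists>p s. \<forall>e. Q e \<longleftrightarrow> sat (\<^bold>\<in>) (assign s e) p)"

abbreviation definable_class :: "('v::zfa \<Rightarrow> bool) \<Rightarrow> bool" where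
  "definable_class P \<equiv> definable (\<lambda>e. P (e 0))"

abbreviation definable_rel :: "('v::zfa \<Rightarrow> 'v \<Rightarrow> bool) \<Rightarrow> bool" where
  "definable_rel P \<equiv> definable (\<lambda>e. P (e 0) (e 1))"

lemma definableI:
  assumes "\<And>e. Q e \<longleftrightarrow> sat (\<^bold>\<in>) (assign s e) p"
  shows "definable Q"
  using assms unfolding definable_def by blast

lemma definableE:
  assumes "definable Q"
  obtains p s where "\<And>e. Q e \<longleftrightarrow> sat (\<^bold>\<in>) (assign s e) p"
  using assms unfolding definable_def by blast

lemma definable_rename:
  assumes "definable Q"
  shows "definable (\<lambda>e. Q (\<lambda>i. e (f i)))"
proof -
  obtain p s where Q: "\<And>e. Q e \<longleftrightarrow> sat (\<^bold>\<in>) (assign s e) p" using assms by (rule definableE) blast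
  have "assign (\<lambda>i. map_sum f id (s i)) e = assign s (\<lambda>i. e (f i))" for e :: "nat \<Rightarrow> 'a"
    by (auto simp: assign_def fun_eq_iff split: sum.split)
  then show ?thesis
    by (intro definableI[where p = p and s = "\<lambda>i. map_sum f id (s i)"]) (simp add: Q)
qed

lemma definable_mem_var: "definable (\<lambda>e. e i \<^bold>\<in> e j)"
  by (rule definableI[where p = "Member i j" and s = Inl]) (simp add: assign_def)

lemma definable_eq_var: "definable (\<lambda>e. e i = e j)"
  by (rule definableI[where p = "Equal i j" and s = Inl]) (simp add: assign_def)

lemma definable_eq_const: "definable (\<lambda>e. e i = c)"
  by (rule definableI[where p = "Equal 0 1" and s = "case_nat (Inl i) (\<lambda>_. Inr c)"])
    (simp add: assign_def)

lemma definable_not: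
  assumes "definable P"
  shows "definable (\<lambda>e. \<not> P e)"
proof -
  obtain p s where "\<And>e. P e \<longleftrightarrow> sat (\<^bold>\<in>) (assign s e) p" using assms by (rule definableE) blast
  then show ?thesis by (intro definableI[where p = "Neg p" and s = s]) simp
qed

lemma definable_conj:
  assumes "definable P" "definable Q"
  shows "definable (\<lambda>e. P e \<and> Q e)"
proof -
  obtain p s where P: "\<And>e. P e \<longleftrightarrow> sat (\<^bold>\<in>) (assign s e) p" using assms(1) by (rule definableE) blast
  obtain q t where Q: "\<And>e. Q e \<longleftrightarrow> sat (\<^bold>\<in>) (assign t e) q" using assms(2) by (rule definableE) blast
  let ?r = "\<lambda>i. if even i then s (i div 2) else t (i div 2)"
  have "(\<lambda>i. assign ?r e (2 * i)) = assign s e" "(\<lambda>i. assign ?r e (Suc (2 * i))) = assign t e" for e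
    by (simp_all add: assign_def fun_eq_iff)
  then show ?thesis
    by (intro definableI[where p = "And (rename (\<lambda>i. 2 * i) p) (rename (\<lambda>i. Suc (2 * i)) q)"
          and s = ?r]) (simp add: P Q sat_rename)
qed

lemma definable_ex:
  assumes "definable (\<lambda>e. P (e 0) (\<lambda>i. e (Suc i)))"
  shows "definable (\<lambda>e. \<exists>x. P x e)"
proof -
  obtain p s where p: "\<And>e. P (e 0) (\<lambda>i. e (Suc i)) \<longleftrightarrow> sat (\<^bold>\<in>) (assign s e) p"
    using assms by (rule definableE) blast
  let ?f = "\<lambda>i. if s i = Inl 0 then 0 else Suc i" and ?t = "\<lambda>i. map_sum (\<lambda>j. j - Suc 0) id (s i)"
  have "assign s (case_nat x e) = (\<lambda>i. case_nat x (assign ?t e) (?f i))" for x e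
    by (auto simp: assign_def fun_eq_iff split: sum.split nat.split)
  then have "P x e \<longleftrightarrow> sat (\<^bold>\<in>) (case_nat x (assign ?t e)) (rename ?f p)" for x e
    using p[of "case_nat x e"] by (simp add: sat_rename)
  then show ?thesis
    by (intro definableI[where p = "Exists (rename ?f p)" and s = ?t]) simp
qed

lemma definable_imp:
  assumes "definable P" "definable Q"
  shows "definable (\<lambda>e. P e \<longrightarrow> Q e)"
  using definable_not[OF definable_conj[OF assms(1) definable_not[OF assms(2)]]] by simp

lemma definable_disj:
  assumes "definable P" "definable Q"
  shows "definable (\<lambda>e. P e \<or> Q e)"
  using definable_imp[OF definable_not[OF assms(1)] assms(2)] by (simp add: disj_imp)

lemma definable_iff:
  assumes "definable P" "definable Q"
  shows "definable (\<lambda>e. P e \<longleftrightarrow> Q e)"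
  using definable_conj[OF definable_imp[OF assms] definable_imp[OF assms(2,1)]]
  by (simp add: iff_conv_conj_imp)

lemma definable_all:
  assumes "definable (\<lambda>e. P (e 0) (\<lambda>i. e (Suc i)))"
  shows "definable (\<lambda>e. \<forall>x. P x e)"
  using definable_not[OF definable_ex[of "\<lambda>x e. \<not> P x e", OF definable_not[OF assms]]] by simp

definition definable_term :: "((nat \<Rightarrow> 'v::zfa) \<Rightarrow> 'v) \<Rightarrow> bool" where
  "definable_term F \<longleftrightarrow> definable (\<lambda>e. e 0 = F (\<lambda>i. e (Suc i)))"

abbreviation definable_fun :: "('v::zfa \<Rightarrow> 'v) \<Rightarrow> bool" where
  "definable_fun F \<equiv> definable_term (\<lambda>e. F (e 0))"

abbreviation definable_fun2 :: "('v::zfa \<Rightarrow> 'v \<Rightarrow> 'v) \<Rightarrow> bool" where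
  "definable_fun2 F \<equiv> definable_term (\<lambda>e. F (e 0) (e 1))"

lemma definable_term_var: "definable_term (\<lambda>e. e i)"
  unfolding definable_term_def by (rule definable_eq_var)

lemma definable_term_const: "definable_term (\<lambda>e. c)"
  unfolding definable_term_def by (rule definable_eq_const)

lemma definable_term_rename:
  assumes "definable_term F"
  shows "definable_term (\<lambda>e. F (\<lambda>i. e (f i)))"
  using definable_rename[OF assms[unfolded definable_term_def], of "case_nat 0 (\<lambda>i. Suc (f i))"]
  unfolding definable_term_def by simp

lemma definable_subst:
  assumes "definable_term F" "definable (\<lambda>e. P (e 0) (\<lambda>i. e (Suc i)))"
  shows "definable (\<lambda>e. P (F e) e)"
proof -
  have "definable (\<lambda>e. \<exists>x. x = F e \<and> P x e)"
    by (rule definable_ex) (rule definable_conj[OF assms(1)[unfolded definable_term_def] assms(2)])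
  then show ?thesis by simp
qed

lemma definable_subst2:
  assumes "definable_term F" "definable_term G"
    and P: "definable (\<lambda>e. P (e 0) (e 1) (\<lambda>i. e (Suc (Suc i))))"
  shows "definable (\<lambda>e. P (F e) (G e) e)"
proof (rule definable_subst[OF assms(1)])
  show "definable (\<lambda>e. P (e 0) (G (\<lambda>i. e (Suc i))) (\<lambda>i. e (Suc i)))"
  proof (rule definable_subst[OF definable_term_rename[OF assms(2)]])
    show "definable (\<lambda>e. P (e (Suc 0)) (e 0) (\<lambda>i. e (Suc (Suc i))))"
      using definable_rename[OF P, of "case_nat 1 (case_nat 0 (\<lambda>i. Suc (Suc i)))"] by simp
  qed
qed

lemma definable_class_comp:
  assumes "definable_class P" "definable_term F"
  shows "definable (\<lambda>e. P (F e))"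
  using definable_subst[OF assms(2), of "\<lambda>x e. P x"] assms(1) by simp

lemma definable_rel_comp:
  assumes "definable_rel P" "definable_term F" "definable_term G"
  shows "definable (\<lambda>e. P (F e) (G e))"
  using definable_subst2[OF assms(2,3), of "\<lambda>x y e. P x y"] assms(1) by simp

lemma definable_fun2_comp:
  assumes "definable_fun2 H" "definable_term F" "definable_term G"
  shows "definable_term (\<lambda>e. H (F e) (G e))"
proof -
  have "definable (\<lambda>e. e 2 = H (e 0) (e 1))"
    using definable_rename[OF assms(1)[unfolded definable_term_def],
        of "case_nat 2 (case_nat 0 (\<lambda>_. 1))"] by simp
  then have "definable (\<lambda>e. e (Suc (Suc 0)) = H (e 0) (e 1))" by (simp only: numeral_2_eq_2)
  then show ?thesis
    unfolding definable_term_def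
    by (rule definable_subst2[OF assms(2,3)[THEN definable_term_rename],
          where P = "\<lambda>x y e. e 0 = H x y"])
qed

lemma definable_fun_comp:
  assumes "definable_fun H" "definable_term F"
  shows "definable_term (\<lambda>e. H (F e))"
  using definable_fun2_comp[of "\<lambda>x _. H x", OF assms(1) assms(2,2)] .

named_theorems definable_intros

lemma definable_mem [definable_intros]:
  assumes "definable_term F" "definable_term G"
  shows "definable (\<lambda>e. F e \<^bold>\<in> G e)"
  using definable_rel_comp[where P = "(\<^bold>\<in>)", OF definable_mem_var assms] .

lemma definable_eq [definable_intros]:
  assumes "definable_term F" "definable_term G"
  shows "definable (\<lambda>e. F e = G e)"
  using definable_rel_comp[where P = "(=)", OF definable_eq_var assms] .

lemmas [definable_intros] = definable_term_var definable_term_const definable_not definable_conj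
  definable_disj definable_imp definable_iff definable_ex definable_all

lemma definable_term_if [definable_intros]:
  assumes "definable P" "definable_term F" "definable_term G"
  shows "definable_term (\<lambda>e. if P e then F e else G e)"
proof -
  have "definable (\<lambda>e. P (\<lambda>i. e (Suc i)))" using assms(1) by (rule definable_rename)
  then have "definable (\<lambda>e. (P (\<lambda>i. e (Suc i)) \<longrightarrow> e 0 = F (\<lambda>i. e (Suc i))) \<and>
      (\<not> P (\<lambda>i. e (Suc i)) \<longrightarrow> e 0 = G (\<lambda>i. e (Suc i))))"
    using assms(2,3)[THEN definable_term_rename] by (intro definable_intros)
  then show ?thesis unfolding definable_term_def by (simp add: if_split[where P = "(=) _"])
qed

lemma definable_is_set [definable_intros]:
  "definable_term F \<Longrightarrow> definable (\<lambda>e. is_set (F e))"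
  unfolding is_set_def by (intro definable_intros)

lemma definable_subset_of [definable_intros]:
  "definable_term F \<Longrightarrow> definable_term G \<Longrightarrow> definable (\<lambda>e. F e \<^bold>\<subseteq> G e)"
  by (rule definable_rel_comp[where P = "(\<^bold>\<subseteq>)"]) (unfold subset_of_def, intro definable_intros)

section \<open>Sets of the model\<close>

lemma not_mem_nul [simp]: "\<not> x \<^bold>\<in> nul"
  by (rule empty_set)

lemma is_set_nul [simp]: "is_set nul"
  unfolding is_set_def using atoms by blast

lemma is_setI: "z \<^bold>\<in> x \<Longrightarrow> is_set x"
  unfolding is_set_def using atoms by blast

lemma set_eqI:
  assumes "is_set x" "is_set y" "\<And>z. z \<^bold>\<in> x \<longleftrightarrow> z \<^bold>\<in> y"
  shows "x = y"
  using extensionality assms unfolding is_set_def by blast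

lemma subset_of_refl: "is_set x \<Longrightarrow> x \<^bold>\<subseteq> x"
  unfolding subset_of_def by blast

lemma subset_of_trans: "x \<^bold>\<subseteq> y \<Longrightarrow> y \<^bold>\<subseteq> z \<Longrightarrow> x \<^bold>\<subseteq> z"
  unfolding subset_of_def by blast

lemma subset_of_antisym: "x \<^bold>\<subseteq> y \<Longrightarrow> y \<^bold>\<subseteq> x \<Longrightarrow> x = y"
  unfolding subset_of_def by (blast intro: set_eqI)

lemma subset_ofD: "x \<^bold>\<subseteq> y \<Longrightarrow> z \<^bold>\<in> x \<Longrightarrow> z \<^bold>\<in> y"
  unfolding subset_of_def by blast

definition small :: "('v::zfa \<Rightarrow> bool) \<Rightarrow> bool" where
  "small P \<longleftrightarrow> (\<exists>v. \<forall>z. z \<^bold>\<in> v \<longleftrightarrow> P z)"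

lemma smallE:
  assumes "small P"
  obtains v where "is_set v" "\<And>z. z \<^bold>\<in> v \<longleftrightarrow> P z"
proof -
  obtain v where v: "\<And>z. z \<^bold>\<in> v \<longleftrightarrow> P z" using assms unfolding small_def by blast
  show thesis
  proof (cases "is_set v")
    case False
    then have "z \<^bold>\<in> nul \<longleftrightarrow> P z" for z using v is_setI by auto
    then show thesis using that[OF is_set_nul] by blast
  qed (use v that in blast)
qed

lemma the_set_eq_iff:
  "v = the_set P \<longleftrightarrow>
     (small P \<longrightarrow> is_set v \<and> (\<forall>z. z \<^bold>\<in> v \<longleftrightarrow> P z)) \<and> (\<not> small P \<longrightarrow> v = (THE w. False))"
proof (cases "small P")
  case True
  then obtain w where w: "is_set w" "\<And>z. z \<^bold>\<in> w \<longleftrightarrow> P z" by (rule smallE) blast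
  have eq: "is_set v \<and> (\<forall>z. z \<^bold>\<in> v \<longleftrightarrow> P z) \<longleftrightarrow> v = w" for v using w set_eqI[of v w] by auto
  then have "the_set P = w" unfolding the_set_def by simp
  then show ?thesis using True eq by simp
next
  case False
  then have no_set: "(is_set w \<and> (\<forall>z. z \<^bold>\<in> w \<longleftrightarrow> P z)) = False" for w
    unfolding small_def by blast
  show ?thesis using False unfolding the_set_def no_set by simp
qed

lemma
  assumes "small P"
  shows is_set_the_set: "is_set (the_set P)"
    and mem_the_set: "z \<^bold>\<in> the_set P \<longleftrightarrow> P z"
  using assms the_set_eq_iff[of "the_set P" P] by blast+

text \<open>Where no such set exists, \<open>the_set\<close> takes one fixed junk value, which serves as a parameter.\<close>

lemma definable_the_set [definable_intros]:
  assumes "definable (\<lambda>e. P (e 0) (\<lambda>i. e (Suc i)))"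
  shows "definable_term (\<lambda>e. the_set (\<lambda>z. P z e))"
proof -
  have "definable (\<lambda>e. P (e 0) (\<lambda>i. e (Suc (Suc i))))"
    "definable (\<lambda>e. P (e 0) (\<lambda>i. e (Suc (Suc (Suc i)))))"
    using definable_rename[OF assms, of "case_nat 0 (\<lambda>i. Suc (Suc i))"]
      definable_rename[OF assms, of "case_nat 0 (\<lambda>i. Suc (Suc (Suc i)))"] by simp_all
  then show ?thesis
    unfolding definable_term_def the_set_eq_iff small_def by (intro definable_intros)
qed

lemma small_mem: "small (\<lambda>z. z \<^bold>\<in> u)"
  unfolding small_def by blast

lemma the_set_mem: "is_set u \<Longrightarrow> the_set (\<lambda>z. z \<^bold>\<in> u) = u"
  by (rule set_eqI) (simp_all add: is_set_the_set mem_the_set small_mem)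

lemma the_set_False: "the_set (\<lambda>z. False) = nul"
  using the_set_mem[OF is_set_nul] by simp

lemma small_Union:
  assumes "small P"
  shows "small (\<lambda>z. \<exists>y. P y \<and> z \<^bold>\<in> y)"
proof -
  obtain u where "\<And>y. y \<^bold>\<in> u \<longleftrightarrow> P y" using assms by (rule smallE) blast
  then show ?thesis using union[of u] unfolding small_def by (simp add: conj_commute)
qed

lemma small_pair: "small (\<lambda>z. z = x \<or> z = y)"
  unfolding small_def by (rule pairing)

lemma small_disj:
  assumes "small P" "small Q"
  shows "small (\<lambda>z. P z \<or> Q z)"
proof -
  obtain u where u: "\<And>z. z \<^bold>\<in> u \<longleftrightarrow> P z" using assms(1) by (rule smallE) blast
  obtain v where v: "\<And>z. z \<^bold>\<in> v \<longleftrightarrow> Q z" using assms(2) by (rule smallE) blast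
  have "(\<lambda>z. \<exists>y. (y = u \<or> y = v) \<and> z \<^bold>\<in> y) = (\<lambda>z. P z \<or> Q z)" using u v by blast
  then show ?thesis using small_Union[OF small_pair[of u v]] by simp
qed

lemma small_separation:
  assumes "small P" "definable_class Q"
  shows "small (\<lambda>z. P z \<and> Q z)"
proof -
  obtain u where u: "\<And>z. z \<^bold>\<in> u \<longleftrightarrow> P z" using assms(1) by (rule smallE) blast
  obtain p s where p: "\<And>e. Q (e 0) \<longleftrightarrow> sat (\<^bold>\<in>) (assign s e) p"
    using assms(2) by (rule definableE) blast
  let ?f = "\<lambda>i. case s i of Inl _ \<Rightarrow> 0 | Inr _ \<Rightarrow> Suc i"
    and ?c = "\<lambda>i. case s i of Inl _ \<Rightarrow> nul | Inr v \<Rightarrow> v"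
  have "assign s (\<lambda>_. x) = (\<lambda>i. case_nat x ?c (?f i))" for x
    by (auto simp: assign_def fun_eq_iff split: sum.split)
  then have "Q x \<longleftrightarrow> sat (\<^bold>\<in>) (case_nat x ?c) (rename ?f p)" for x
    using p[of "\<lambda>_. x"] by (simp add: sat_rename)
  then show ?thesis using separation[of u ?c "rename ?f p"] unfolding small_def by (simp add: u)
qed

lemma small_replacement:
  assumes "definable_rel P" and functional: "\<And>x y z. x \<^bold>\<in> u \<Longrightarrow> P x y \<Longrightarrow> P x z \<Longrightarrow> y = z"
  shows "small (\<lambda>y. \<exists>x. x \<^bold>\<in> u \<and> P x y)"
proof -
  obtain p s where p: "\<And>e. P (e 0) (e 1) \<longleftrightarrow> sat (\<^bold>\<in>) (assign s e) p"
    using assms(1) by (rule definableE) blast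
  let ?f = "\<lambda>i. case s i of Inl j \<Rightarrow> (if j = 0 then 0 else 1) | Inr _ \<Rightarrow> Suc (Suc i)"
    and ?c = "\<lambda>i. case s i of Inl _ \<Rightarrow> nul | Inr v \<Rightarrow> v"
  have "assign s (case_nat x (\<lambda>_. y)) = (\<lambda>i. case_nat x (case_nat y ?c) (?f i))" for x y
    by (auto simp: assign_def fun_eq_iff split: sum.split nat.split)
  then have sat_iff: "P x y \<longleftrightarrow> sat (\<^bold>\<in>) (case_nat x (case_nat y ?c)) (rename ?f p)" for x y
    using p[of "case_nat x (\<lambda>_. y)"] by (simp add: sat_rename)
  show ?thesis
    unfolding small_def sat_iff by (rule replacement) (rule functional[unfolded sat_iff])
qed

lemma small_image:
  assumes "definable_fun F"
  shows "small (\<lambda>y. \<exists>x. x \<^bold>\<in> u \<and> y = F x)"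
proof (rule small_replacement)
  show "definable (\<lambda>e. e 1 = F (e 0))" by (intro definable_eq definable_term_var assms)
qed simp

lemma small_UN:
  assumes "definable_fun F"
  shows "small (\<lambda>z. \<exists>x. x \<^bold>\<in> u \<and> z \<^bold>\<in> F x)"
proof -
  have "small (\<lambda>z. \<exists>y. (\<exists>x. x \<^bold>\<in> u \<and> y = F x) \<and> z \<^bold>\<in> y)"
    by (rule small_Union[OF small_image[OF assms]])
  moreover have "(\<exists>y. (\<exists>x. x \<^bold>\<in> u \<and> y = F x) \<and> z \<^bold>\<in> y) \<longleftrightarrow> (\<exists>x. x \<^bold>\<in> u \<and> z \<^bold>\<in> F x)" for z
    by blast
  ultimately show ?thesis by (simp only:)
qed

lemma small_subset_of: "small (\<lambda>x. x \<^bold>\<subseteq> u)"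
proof -
  have "small (\<lambda>x. is_set x \<and> (\<forall>z. z \<^bold>\<in> x \<longrightarrow> z \<^bold>\<in> u))"
    using powerset unfolding small_def is_set_def by blast
  then have "small (\<lambda>x. (is_set x \<and> (\<forall>z. z \<^bold>\<in> x \<longrightarrow> z \<^bold>\<in> u)) \<and> x \<^bold>\<subseteq> u)"
    by (rule small_separation) (intro definable_intros)
  moreover have "(is_set x \<and> (\<forall>z. z \<^bold>\<in> x \<longrightarrow> z \<^bold>\<in> u)) \<and> x \<^bold>\<subseteq> u \<longleftrightarrow> x \<^bold>\<subseteq> u" for x
    unfolding subset_of_def by blast
  ultimately show ?thesis by (simp only: simp_thms)
qed

lemma mem_upair [simp]: "z \<^bold>\<in> upair x y \<longleftrightarrow> z = x \<or> z = y"
  unfolding upair_def by (rule mem_the_set[OF small_pair])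

lemma is_set_upair [simp]: "is_set (upair x y)"
  unfolding upair_def by (rule is_set_the_set[OF small_pair])

lemma upair_eq_iff: "upair x y = upair u v \<longleftrightarrow> x = u \<and> y = v \<or> x = v \<and> y = u"
proof
  assume "upair x y = upair u v"
  then have "z = x \<or> z = y \<longleftrightarrow> z = u \<or> z = v" for z using mem_upair by metis
  then show "x = u \<and> y = v \<or> x = v \<and> y = u" by metis
qed (auto intro: set_eqI)

lemma mem_irrefl [simp]: "\<not> x \<^bold>\<in> x"
  using foundation[of "upair x x"] by auto

lemma mem_asym: "x \<^bold>\<in> y \<Longrightarrow> \<not> y \<^bold>\<in> x"
  using foundation[of "upair x y"] by auto

lemma kpair_eq_iff [simp]: "kpair x y = kpair u v \<longleftrightarrow> x = u \<and> y = v"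
  unfolding kpair_def by (auto simp: upair_eq_iff)

lemma mem_un [simp]: "z \<^bold>\<in> x \<^bold>\<union> y \<longleftrightarrow> z \<^bold>\<in> x \<or> z \<^bold>\<in> y"
  unfolding un_def by (rule mem_the_set[OF small_disj[OF small_mem small_mem]])

lemma is_set_un [simp]: "is_set (x \<^bold>\<union> y)"
  unfolding un_def by (rule is_set_the_set[OF small_disj[OF small_mem small_mem]])

definition big_union :: "'v::zfa \<Rightarrow> 'v" where
  "big_union u = the_set (\<lambda>z. \<exists>y. y \<^bold>\<in> u \<and> z \<^bold>\<in> y)"

lemma mem_big_union [simp]: "z \<^bold>\<in> big_union u \<longleftrightarrow> (\<exists>y. y \<^bold>\<in> u \<and> z \<^bold>\<in> y)"
  unfolding big_union_def by (rule mem_the_set[OF small_Union[OF small_mem]])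

lemma is_set_big_union [simp]: "is_set (big_union u)"
  unfolding big_union_def by (rule is_set_the_set[OF small_Union[OF small_mem]])

lemma small_osucc: "small (\<lambda>z. z \<^bold>\<in> x \<or> z = x)"
  using small_disj[OF small_mem small_pair[of x x]] by simp

lemma mem_osucc [simp]: "z \<^bold>\<in> osucc x \<longleftrightarrow> z \<^bold>\<in> x \<or> z = x"
  unfolding osucc_def by (rule mem_the_set[OF small_osucc])

lemma is_set_osucc [simp]: "is_set (osucc x)"
  unfolding osucc_def by (rule is_set_the_set[OF small_osucc])

lemma osucc_neq_nul [simp]: "osucc x \<noteq> nul"
  using mem_osucc[of x x] not_mem_nul[of x] by metis

lemma osucc_inject [simp]: "osucc x = osucc y \<longleftrightarrow> x = y"
proof
  assume "osucc x = osucc y"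
  then have "x \<^bold>\<in> osucc y" "y \<^bold>\<in> osucc x" using mem_osucc by metis+
  then show "x = y" using mem_asym[of x y] by auto
qed simp

lemma definable_upair [definable_intros]:
  "definable_term F \<Longrightarrow> definable_term G \<Longrightarrow> definable_term (\<lambda>e. upair (F e) (G e))"
  by (rule definable_fun2_comp[where H = upair]) (unfold upair_def, intro definable_intros)

lemma definable_kpair [definable_intros]:
  "definable_term F \<Longrightarrow> definable_term G \<Longrightarrow> definable_term (\<lambda>e. kpair (F e) (G e))"
  unfolding kpair_def by (intro definable_intros)

lemma definable_atom_le [definable_intros]:
  "definable_term F \<Longrightarrow> definable_term G \<Longrightarrow> definable (\<lambda>e. atom_le R (F e) (G e))"
  unfolding atom_le_def by (intro definable_intros)

lemma definable_osucc [definable_intros]: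
  "definable_term F \<Longrightarrow> definable_term (\<lambda>e. osucc (F e))"
  by (rule definable_fun_comp[where H = osucc]) (unfold osucc_def, intro definable_intros)

section \<open>Ordinals\<close>

lemma definable_transitive_set [definable_intros]:
  "definable_term F \<Longrightarrow> definable (\<lambda>e. transitive_set (F e))"
  by (rule definable_class_comp[where P = transitive_set])
    (unfold transitive_set_def, intro definable_intros)

lemma definable_ordinal [definable_intros]:
  "definable_term F \<Longrightarrow> definable (\<lambda>e. ordinal (F e))"
  by (rule definable_class_comp[where P = ordinal]) (unfold ordinal_def, intro definable_intros)

lemma definable_limit_ordinal [definable_intros]:
  "definable_term F \<Longrightarrow> definable (\<lambda>e. limit_ordinal (F e))"
  by (rule definable_class_comp[where P = limit_ordinal])
    (unfold limit_ordinal_def, intro definable_intros)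

lemma ordinalI:
  assumes "is_set \<alpha>" "\<And>\<beta>. \<beta> \<^bold>\<in> \<alpha> \<Longrightarrow> ordinal \<beta>" "\<And>\<beta> \<gamma>. \<beta> \<^bold>\<in> \<alpha> \<Longrightarrow> \<gamma> \<^bold>\<in> \<beta> \<Longrightarrow> \<gamma> \<^bold>\<in> \<alpha>"
  shows "ordinal \<alpha>"
  using assms unfolding ordinal_def transitive_set_def by blast

lemma ordinal_is_set: "ordinal \<alpha> \<Longrightarrow> is_set \<alpha>"
  unfolding ordinal_def transitive_set_def by blast

lemma ordinal_mem: "ordinal \<alpha> \<Longrightarrow> \<beta> \<^bold>\<in> \<alpha> \<Longrightarrow> ordinal \<beta>"
  unfolding ordinal_def transitive_set_def by blast

lemma ordinal_trans: "ordinal \<alpha> \<Longrightarrow> \<beta> \<^bold>\<in> \<alpha> \<Longrightarrow> \<gamma> \<^bold>\<in> \<beta> \<Longrightarrow> \<gamma> \<^bold>\<in> \<alpha>"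
  unfolding ordinal_def transitive_set_def by blast

lemma limit_ordinal_is_ordinal: "limit_ordinal \<alpha> \<Longrightarrow> ordinal \<alpha>"
  unfolding limit_ordinal_def by blast

lemma limit_ordinal_neq_nul: "limit_ordinal \<alpha> \<Longrightarrow> \<alpha> \<noteq> nul"
  unfolding limit_ordinal_def by blast

lemma limit_ordinal_osucc: "limit_ordinal \<alpha> \<Longrightarrow> \<beta> \<^bold>\<in> \<alpha> \<Longrightarrow> osucc \<beta> \<^bold>\<in> \<alpha>"
  unfolding limit_ordinal_def by blast

lemma ordinal_nul [simp]: "ordinal nul"
  by (rule ordinalI) simp_all

lemma ordinal_osucc [simp]:
  assumes "ordinal \<alpha>"
  shows "ordinal (osucc \<alpha>)"
  by (rule ordinalI) (use assms ordinal_mem ordinal_trans in auto)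

lemma not_limit_osucc [simp]: "\<not> limit_ordinal (osucc \<alpha>)"
  using limit_ordinal_osucc[of "osucc \<alpha>" \<alpha>] by (metis mem_irrefl mem_osucc)

lemma ordinal_least:
  assumes "definable_class P" "ordinal \<alpha>" "P \<alpha>"
  obtains \<beta> where "ordinal \<beta>" "P \<beta>" "\<And>\<gamma>. \<gamma> \<^bold>\<in> \<beta> \<Longrightarrow> \<not> P \<gamma>"
proof -
  obtain v where v: "\<And>x. x \<^bold>\<in> v \<longleftrightarrow> x \<^bold>\<in> osucc \<alpha> \<and> P x"
    using small_separation[OF small_mem assms(1)] by (rule smallE) blast
  have "\<alpha> \<^bold>\<in> v" using v assms(3) by simp
  then obtain \<beta> where \<beta>: "\<beta> \<^bold>\<in> v" "\<not> (\<exists>\<gamma>. \<gamma> \<^bold>\<in> \<beta> \<and> \<gamma> \<^bold>\<in> v)" using foundation[of v] by blast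
  show thesis
  proof (rule that)
    have "ordinal (osucc \<alpha>)" using assms(2) by simp
    moreover have "\<beta> \<^bold>\<in> osucc \<alpha>" using \<beta>(1) v by blast
    ultimately show "ordinal \<beta>" by (rule ordinal_mem)
    show "P \<beta>" using \<beta>(1) v by blast
    show "\<not> P \<gamma>" if "\<gamma> \<^bold>\<in> \<beta>" for \<gamma>
      using \<beta> v that ordinal_trans[OF \<open>ordinal (osucc \<alpha>)\<close> \<open>\<beta> \<^bold>\<in> osucc \<alpha>\<close>] by blast
  qed
qed

lemma ordinal_induct [consumes 1, case_names definable step]:
  assumes "ordinal \<alpha>" "definable_class P"
    and step: "\<And>\<alpha>. ordinal \<alpha> \<Longrightarrow> (\<And>\<beta>. \<beta> \<^bold>\<in> \<alpha> \<Longrightarrow> P \<beta>) \<Longrightarrow> P \<alpha>"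
  shows "P \<alpha>"
proof (rule ccontr)
  assume "\<not> P \<alpha>"
  with definable_not[OF assms(2)] assms(1) obtain \<beta>
    where "ordinal \<beta>" "\<not> P \<beta>" "\<And>\<gamma>. \<gamma> \<^bold>\<in> \<beta> \<Longrightarrow> \<not> \<not> P \<gamma>" by (rule ordinal_least) blast
  then show False using step by blast
qed

lemma ordinal_linear:
  assumes "ordinal \<alpha>" "ordinal \<beta>"
  shows "\<alpha> \<^bold>\<in> \<beta> \<or> \<alpha> = \<beta> \<or> \<beta> \<^bold>\<in> \<alpha>"
proof -
  have "\<forall>\<beta>. ordinal \<beta> \<longrightarrow> \<alpha> \<^bold>\<in> \<beta> \<or> \<alpha> = \<beta> \<or> \<beta> \<^bold>\<in> \<alpha>"
    using assms(1)
  proof (induction \<alpha> rule: ordinal_induct)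
    case definable
    show ?case by (intro definable_intros)
  next
    case outer: (step \<alpha>)
    have "\<alpha> \<^bold>\<in> \<beta> \<or> \<alpha> = \<beta> \<or> \<beta> \<^bold>\<in> \<alpha>" if "ordinal \<beta>" for \<beta>
      using that
    proof (induction \<beta> rule: ordinal_induct)
      case definable
      show ?case by (intro definable_intros)
    next
      case inner: (step \<beta>)
      have "\<alpha> = \<beta>" if "\<not> \<alpha> \<^bold>\<in> \<beta>" "\<not> \<beta> \<^bold>\<in> \<alpha>"
      proof (rule set_eqI)
        show "is_set \<alpha>" "is_set \<beta>" using outer(1) inner(1) by (auto intro: ordinal_is_set)
        show "\<gamma> \<^bold>\<in> \<alpha> \<longleftrightarrow> \<gamma> \<^bold>\<in> \<beta>" for \<gamma>
          using outer.IH[of \<gamma>] inner.IH[of \<gamma>] that inner(1)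
            ordinal_trans[OF outer(1), of \<gamma> \<beta>] ordinal_trans[OF inner(1), of \<gamma> \<alpha>] by blast
      qed
      then show ?case by blast
    qed
    then show ?case by blast
  qed
  then show ?thesis using assms(2) by blast
qed

lemma osucc_mem_osucc:
  assumes "ordinal \<beta>" "\<alpha> \<^bold>\<in> \<beta>"
  shows "osucc \<alpha> \<^bold>\<in> osucc \<beta>"
proof -
  have "\<not> \<beta> \<^bold>\<in> osucc \<alpha>" using assms mem_asym by auto
  then show ?thesis using ordinal_linear[of "osucc \<alpha>" \<beta>] assms ordinal_mem[OF assms] by auto
qed

lemma ordinal_cases:
  assumes "ordinal \<alpha>"
  obtains (nul) "\<alpha> = nul" | (osucc) \<beta> where "ordinal \<beta>" "\<alpha> = osucc \<beta>" | (limit) "limit_ordinal \<alpha>"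
proof (cases "\<alpha> = nul \<or> limit_ordinal \<alpha>")
  case False
  then obtain \<beta> where \<beta>: "\<beta> \<^bold>\<in> \<alpha>" "\<not> osucc \<beta> \<^bold>\<in> \<alpha>" using assms unfolding limit_ordinal_def by blast
  then have "\<alpha> = osucc \<beta>" using osucc_mem_osucc[OF assms] by auto
  then show thesis using osucc ordinal_mem[OF assms \<beta>(1)] by blast
qed (use nul limit in blast)

lemma ordinal_big_union:
  assumes "\<And>\<beta>. \<beta> \<^bold>\<in> u \<Longrightarrow> ordinal \<beta>"
  shows "ordinal (big_union u)"
proof (rule ordinalI)
  show "ordinal \<gamma>" if "\<gamma> \<^bold>\<in> big_union u" for \<gamma>
    using that assms ordinal_mem unfolding mem_big_union by blast
  show "\<delta> \<^bold>\<in> big_union u" if "\<gamma> \<^bold>\<in> big_union u" "\<delta> \<^bold>\<in> \<gamma>" for \<gamma> \<delta>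
    using that assms ordinal_trans unfolding mem_big_union by blast
qed simp

section \<open>Recursion on the ordinals\<close>

definition is_relation :: "'v::zfa \<Rightarrow> bool" where
  "is_relation f \<longleftrightarrow> is_set f \<and> (\<forall>p. p \<^bold>\<in> f \<longrightarrow> (\<exists>x y. p = kpair x y))"

lemma relation_eqI:
  assumes "is_relation f" "is_relation g" "\<And>x y. kpair x y \<^bold>\<in> f \<longleftrightarrow> kpair x y \<^bold>\<in> g"
  shows "f = g"
proof (rule set_eqI)
  show "is_set f" "is_set g" using assms(1,2) unfolding is_relation_def by blast+
  show "p \<^bold>\<in> f \<longleftrightarrow> p \<^bold>\<in> g" for p using assms unfolding is_relation_def by blast
qed

definition restrict :: "'v::zfa \<Rightarrow> 'v \<Rightarrow> 'v" where
  "restrict f a = the_set (\<lambda>p. p \<^bold>\<in> f \<and> (\<exists>x y. x \<^bold>\<in> a \<and> p = kpair x y))"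

lemma
  shows is_relation_restrict: "is_relation (restrict f a)"
    and kpair_mem_restrict [simp]: "kpair x y \<^bold>\<in> restrict f a \<longleftrightarrow> x \<^bold>\<in> a \<and> kpair x y \<^bold>\<in> f"
proof -
  have "small (\<lambda>p. p \<^bold>\<in> f \<and> (\<exists>x y. x \<^bold>\<in> a \<and> p = kpair x y))"
    by (rule small_separation[OF small_mem]) (intro definable_intros)
  then show "is_relation (restrict f a)" "kpair x y \<^bold>\<in> restrict f a \<longleftrightarrow> x \<^bold>\<in> a \<and> kpair x y \<^bold>\<in> f"
    unfolding is_relation_def restrict_def by (auto simp: is_set_the_set mem_the_set)
qed

definition graph_on :: "('v::zfa \<Rightarrow> 'v) \<Rightarrow> 'v \<Rightarrow> 'v" where
  "graph_on F a = the_set (\<lambda>p. \<exists>x. x \<^bold>\<in> a \<and> p = kpair x (F x))"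

lemma
  assumes "definable_fun F"
  shows is_relation_graph_on: "is_relation (graph_on F a)"
    and kpair_mem_graph_on: "kpair x y \<^bold>\<in> graph_on F a \<longleftrightarrow> x \<^bold>\<in> a \<and> y = F x"
proof -
  have "small (\<lambda>p. \<exists>x. x \<^bold>\<in> a \<and> p = kpair x (F x))"
    using assms by (intro small_image definable_kpair definable_term_var)
  then show "is_relation (graph_on F a)" "kpair x y \<^bold>\<in> graph_on F a \<longleftrightarrow> x \<^bold>\<in> a \<and> y = F x"
    unfolding is_relation_def graph_on_def by (auto simp: is_set_the_set mem_the_set)
qed

lemma definable_is_relation [definable_intros]:
  "definable_term F \<Longrightarrow> definable (\<lambda>e. is_relation (F e))"
  by (rule definable_class_comp[where P = is_relation])
    (unfold is_relation_def, intro definable_intros)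

lemma definable_restrict [definable_intros]:
  "definable_term F \<Longrightarrow> definable_term G \<Longrightarrow> definable_term (\<lambda>e. restrict (F e) (G e))"
  by (rule definable_fun2_comp[where H = restrict]) (unfold restrict_def, intro definable_intros)

definition recursion_on :: "('v::zfa \<Rightarrow> 'v \<Rightarrow> 'v) \<Rightarrow> 'v \<Rightarrow> 'v \<Rightarrow> bool" where
  "recursion_on G \<alpha> f \<longleftrightarrow> ordinal \<alpha> \<and> is_relation f \<and>
     (\<forall>\<beta> y. kpair \<beta> y \<^bold>\<in> f \<longleftrightarrow> \<beta> \<^bold>\<in> \<alpha> \<and> y = G \<beta> (restrict f \<beta>))"

definition ordinal_rec :: "('v::zfa \<Rightarrow> 'v \<Rightarrow> 'v) \<Rightarrow> 'v \<Rightarrow> 'v" where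
  "ordinal_rec G \<alpha> =
     (if ordinal \<alpha> then THE y. \<exists>f. recursion_on G \<alpha> f \<and> y = G \<alpha> f else nul)"

lemma recursion_on_ordinal: "recursion_on G \<alpha> f \<Longrightarrow> ordinal \<alpha>"
  unfolding recursion_on_def by blast

lemma recursion_on_relation: "recursion_on G \<alpha> f \<Longrightarrow> is_relation f"
  unfolding recursion_on_def by blast

lemma kpair_mem_recursion_on:
  "recursion_on G \<alpha> f \<Longrightarrow> kpair \<beta> y \<^bold>\<in> f \<longleftrightarrow> \<beta> \<^bold>\<in> \<alpha> \<and> y = G \<beta> (restrict f \<beta>)"
  unfolding recursion_on_def by blast

lemma recursion_on_restrict:
  assumes f: "recursion_on G \<alpha> f" and "\<beta> \<^bold>\<in> \<alpha>"
  shows "recursion_on G \<beta> (restrict f \<beta>)"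
proof -
  have \<alpha>: "ordinal \<alpha>" using f by (rule recursion_on_ordinal)
  then have \<beta>: "ordinal \<beta>" using ordinal_mem assms(2) by blast
  have "restrict (restrict f \<beta>) \<gamma> = restrict f \<gamma>" if "\<gamma> \<^bold>\<in> \<beta>" for \<gamma>
    by (rule relation_eqI) (use is_relation_restrict ordinal_trans[OF \<beta> that] in auto)
  then have "kpair \<gamma> y \<^bold>\<in> restrict f \<beta> \<longleftrightarrow> \<gamma> \<^bold>\<in> \<beta> \<and> y = G \<gamma> (restrict (restrict f \<beta>) \<gamma>)" for \<gamma> y
    using ordinal_trans[OF \<alpha> assms(2)] by (auto simp: kpair_mem_recursion_on[OF f])
  then show ?thesis
    using \<beta> is_relation_restrict unfolding recursion_on_def by blast
qed

context
  fixes G :: "'v::zfa \<Rightarrow> 'v \<Rightarrow> 'v"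
  assumes definable_G: "definable_fun2 G"
begin

lemma definable_recursion_on [definable_intros]:
  "definable_term F \<Longrightarrow> definable_term H \<Longrightarrow> definable (\<lambda>e. recursion_on G (F e) (H e))"
  by (rule definable_rel_comp[where P = "recursion_on G"])
    (unfold recursion_on_def, intro definable_intros definable_fun2_comp[OF definable_G])

lemma recursion_on_unique:
  assumes "recursion_on G \<alpha> f" "recursion_on G \<alpha> g"
  shows "f = g"
proof -
  have "ordinal \<alpha>" using assms(1) by (rule recursion_on_ordinal)
  then have "\<forall>f g. recursion_on G \<alpha> f \<longrightarrow> recursion_on G \<alpha> g \<longrightarrow> f = g"
  proof (induction \<alpha> rule: ordinal_induct)
    case definable
    show ?case by (intro definable_intros)
  next
    case (step \<alpha>)
    have "f = g" if f: "recursion_on G \<alpha> f" and g: "recursion_on G \<alpha> g" for f g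
    proof (rule relation_eqI)
      show "is_relation f" using f by (rule recursion_on_relation)
      show "is_relation g" using g by (rule recursion_on_relation)
      have "restrict f \<beta> = restrict g \<beta>" if "\<beta> \<^bold>\<in> \<alpha>" for \<beta>
        using step.IH[OF that] f[THEN recursion_on_restrict, OF that]
          g[THEN recursion_on_restrict, OF that] by blast
      then show "kpair \<beta> y \<^bold>\<in> f \<longleftrightarrow> kpair \<beta> y \<^bold>\<in> g" for \<beta> y
        by (auto simp: kpair_mem_recursion_on[OF f] kpair_mem_recursion_on[OF g])
    qed
    then show ?case by blast
  qed
  then show ?thesis using assms by blast
qed

lemma recursion_on_exists:
  assumes "ordinal \<alpha>"
  shows "\<exists>f. recursion_on G \<alpha> f"
  using assms
proof (induction \<alpha> rule: ordinal_induct)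
  case definable
  show ?case by (intro definable_intros)
next
  case (step \<alpha>)
  have "small (\<lambda>p. \<exists>\<beta>. \<beta> \<^bold>\<in> \<alpha> \<and> (\<exists>g. recursion_on G \<beta> g \<and> p = kpair \<beta> (G \<beta> g)))"
  proof (rule small_replacement)
    show "definable (\<lambda>e. \<exists>g. recursion_on G (e 0) g \<and> e 1 = kpair (e 0) (G (e 0) g))"
      by (intro definable_intros definable_fun2_comp[OF definable_G])
  qed (use recursion_on_unique in blast)
  then obtain f where "is_set f"
    and f: "\<And>p. p \<^bold>\<in> f \<longleftrightarrow> (\<exists>\<beta>. \<beta> \<^bold>\<in> \<alpha> \<and> (\<exists>g. recursion_on G \<beta> g \<and> p = kpair \<beta> (G \<beta> g)))"
    by (rule smallE) blast
  have relation: "is_relation f" using \<open>is_set f\<close> unfolding is_relation_def f by blast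
  have mem_f: "kpair \<beta> y \<^bold>\<in> f \<longleftrightarrow> \<beta> \<^bold>\<in> \<alpha> \<and> y = G \<beta> g" if "recursion_on G \<beta> g" for \<beta> y g
    unfolding f kpair_eq_iff using recursion_on_unique[OF that] that by blast
  have restrict_f: "restrict f \<beta> = g" if "\<beta> \<^bold>\<in> \<alpha>" and g: "recursion_on G \<beta> g" for \<beta> g
  proof (rule relation_eqI)
    show "is_relation g" using g by (rule recursion_on_relation)
    have "kpair \<gamma> y \<^bold>\<in> f \<longleftrightarrow> y = G \<gamma> (restrict g \<gamma>)" if "\<gamma> \<^bold>\<in> \<beta>" for \<gamma> y
      using mem_f[OF recursion_on_restrict[OF g that]] ordinal_trans[OF step(1) \<open>\<beta> \<^bold>\<in> \<alpha>\<close> that]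
      by blast
    then show "kpair \<gamma> y \<^bold>\<in> restrict f \<beta> \<longleftrightarrow> kpair \<gamma> y \<^bold>\<in> g" for \<gamma> y
      unfolding kpair_mem_restrict kpair_mem_recursion_on[OF g] by blast
  qed (rule is_relation_restrict)
  have "kpair \<beta> y \<^bold>\<in> f \<longleftrightarrow> \<beta> \<^bold>\<in> \<alpha> \<and> y = G \<beta> (restrict f \<beta>)" for \<beta> y
  proof (cases "\<beta> \<^bold>\<in> \<alpha>")
    case True
    then obtain g where "recursion_on G \<beta> g" using step.IH by blast
    then show ?thesis using mem_f restrict_f True by blast
  qed (use f in auto)
  then show ?case using step(1) relation unfolding recursion_on_def by blast
qed

lemma ordinal_rec_eq:
  assumes "recursion_on G \<alpha> f"
  shows "ordinal_rec G \<alpha> = G \<alpha> f"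
proof -
  have "ordinal \<alpha>" using assms by (rule recursion_on_ordinal)
  moreover have "(THE y. \<exists>f. recursion_on G \<alpha> f \<and> y = G \<alpha> f) = G \<alpha> f"
    using assms recursion_on_unique[OF assms] by (intro the_equality) blast+
  ultimately show ?thesis unfolding ordinal_rec_def by simp
qed

lemma definable_ordinal_rec [definable_intros]:
  assumes "definable_term F"
  shows "definable_term (\<lambda>e. ordinal_rec G (F e))"
proof (rule definable_fun_comp[where H = "ordinal_rec G", OF _ assms])
  have eq_iff: "y = ordinal_rec G \<alpha> \<longleftrightarrow>
      (\<exists>f. recursion_on G \<alpha> f \<and> y = G \<alpha> f) \<or> \<not> ordinal \<alpha> \<and> y = nul" for y \<alpha>
  proof (cases "ordinal \<alpha>")
    case True
    then obtain f where "recursion_on G \<alpha> f" using recursion_on_exists by blast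
    then show ?thesis using ordinal_rec_eq True by metis
  qed (simp add: ordinal_rec_def recursion_on_def)
  show "definable_fun (ordinal_rec G)"
    unfolding definable_term_def eq_iff
    by (intro definable_intros definable_fun2_comp[OF definable_G])
qed

theorem ordinal_rec_unfold:
  assumes "ordinal \<alpha>"
  shows "ordinal_rec G \<alpha> = G \<alpha> (graph_on (ordinal_rec G) \<alpha>)"
proof -
  obtain f where f: "recursion_on G \<alpha> f" using recursion_on_exists assms by blast
  have definable: "definable_fun (ordinal_rec G)" by (intro definable_intros)
  have "f = graph_on (ordinal_rec G) \<alpha>"
  proof (rule relation_eqI)
    show "is_relation f" using f by (rule recursion_on_relation)
    show "is_relation (graph_on (ordinal_rec G) \<alpha>)" by (rule is_relation_graph_on[OF definable])
    show "kpair \<beta> y \<^bold>\<in> f \<longleftrightarrow> kpair \<beta> y \<^bold>\<in> graph_on (ordinal_rec G) \<alpha>" for \<beta> y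
      unfolding kpair_mem_graph_on[OF definable] kpair_mem_recursion_on[OF f]
      using ordinal_rec_eq[OF recursion_on_restrict[OF f]] by auto
  qed
  then show ?thesis using ordinal_rec_eq[OF f] by simp
qed

end

section \<open>Limit ordinals above given ordinals\<close>

definition ordinal_add :: "'v::zfa \<Rightarrow> 'v \<Rightarrow> 'v" where
  "ordinal_add \<alpha> = ordinal_rec (\<lambda>\<beta> f. the_set (\<lambda>\<delta>. \<delta> \<^bold>\<in> \<alpha> \<or> (\<exists>\<gamma>. kpair \<gamma> \<delta> \<^bold>\<in> f)))"

lemma definable_ordinal_add: "definable_fun (ordinal_add \<alpha>)"
  unfolding ordinal_add_def by (intro definable_intros)

lemma
  assumes "ordinal \<beta>"
  shows is_set_ordinal_add: "is_set (ordinal_add \<alpha> \<beta>)"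
    and mem_ordinal_add: "\<delta> \<^bold>\<in> ordinal_add \<alpha> \<beta> \<longleftrightarrow> \<delta> \<^bold>\<in> \<alpha> \<or> (\<exists>\<gamma>. \<gamma> \<^bold>\<in> \<beta> \<and> \<delta> = ordinal_add \<alpha> \<gamma>)"
proof -
  let ?G = "\<lambda>\<beta> f. the_set (\<lambda>\<delta>. \<delta> \<^bold>\<in> \<alpha> \<or> (\<exists>\<gamma>. kpair \<gamma> \<delta> \<^bold>\<in> f))"
  have "definable_fun2 ?G" by (intro definable_intros)
  then have "ordinal_add \<alpha> \<beta> = ?G \<beta> (graph_on (ordinal_add \<alpha>) \<beta>)"
    unfolding ordinal_add_def by (rule ordinal_rec_unfold[OF _ assms])
  then have "ordinal_add \<alpha> \<beta> = the_set (\<lambda>\<delta>. \<delta> \<^bold>\<in> \<alpha> \<or> (\<exists>\<gamma>. \<gamma> \<^bold>\<in> \<beta> \<and> \<delta> = ordinal_add \<alpha> \<gamma>))"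
    by (simp only: kpair_mem_graph_on[OF definable_ordinal_add])
  moreover have "small (\<lambda>\<delta>. \<delta> \<^bold>\<in> \<alpha> \<or> (\<exists>\<gamma>. \<gamma> \<^bold>\<in> \<beta> \<and> \<delta> = ordinal_add \<alpha> \<gamma>))"
    by (intro small_disj small_mem small_image definable_ordinal_add)
  ultimately show "is_set (ordinal_add \<alpha> \<beta>)"
    "\<delta> \<^bold>\<in> ordinal_add \<alpha> \<beta> \<longleftrightarrow> \<delta> \<^bold>\<in> \<alpha> \<or> (\<exists>\<gamma>. \<gamma> \<^bold>\<in> \<beta> \<and> \<delta> = ordinal_add \<alpha> \<gamma>)"
    by (simp_all add: is_set_the_set mem_the_set)
qed

lemma ordinal_add_nul:
  assumes "ordinal \<alpha>"
  shows "ordinal_add \<alpha> nul = \<alpha>"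
proof (rule set_eqI)
  show "\<delta> \<^bold>\<in> ordinal_add \<alpha> nul \<longleftrightarrow> \<delta> \<^bold>\<in> \<alpha>" for \<delta> unfolding mem_ordinal_add[OF ordinal_nul] by simp
qed (use assms in \<open>simp_all add: ordinal_is_set is_set_ordinal_add\<close>)

lemma ordinal_add_osucc:
  assumes "ordinal \<beta>"
  shows "ordinal_add \<alpha> (osucc \<beta>) = osucc (ordinal_add \<alpha> \<beta>)"
proof (rule set_eqI)
  show "\<delta> \<^bold>\<in> ordinal_add \<alpha> (osucc \<beta>) \<longleftrightarrow> \<delta> \<^bold>\<in> osucc (ordinal_add \<alpha> \<beta>)" for \<delta>
    unfolding mem_osucc mem_ordinal_add[OF assms] mem_ordinal_add[OF ordinal_osucc[OF assms]]
    by blast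
qed (use assms in \<open>simp_all add: is_set_ordinal_add\<close>)

lemma ordinal_ordinal_add:
  assumes "ordinal \<alpha>" "ordinal \<beta>"
  shows "ordinal (ordinal_add \<alpha> \<beta>)"
  using assms(2)
proof (induction \<beta> rule: ordinal_induct)
  case definable
  show ?case by (intro definable_ordinal definable_ordinal_add)
next
  case (step \<beta>)
  show ?case
  proof (rule ordinalI)
    show "is_set (ordinal_add \<alpha> \<beta>)" using step(1) by (rule is_set_ordinal_add)
    show "ordinal \<delta>" if "\<delta> \<^bold>\<in> ordinal_add \<alpha> \<beta>" for \<delta>
      using that assms(1) ordinal_mem step.IH unfolding mem_ordinal_add[OF step(1)] by blast
    show "\<epsilon> \<^bold>\<in> ordinal_add \<alpha> \<beta>" if "\<delta> \<^bold>\<in> ordinal_add \<alpha> \<beta>" "\<epsilon> \<^bold>\<in> \<delta>" for \<delta> \<epsilon>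
      using that ordinal_trans[OF assms(1)] ordinal_trans[OF step(1)]
        mem_ordinal_add[OF ordinal_mem[OF step(1)]]
      unfolding mem_ordinal_add[OF step(1)] by blast
  qed
qed

lemma limit_ordinal_add:
  assumes "ordinal \<alpha>" "limit_ordinal \<beta>"
  shows "limit_ordinal (ordinal_add \<alpha> \<beta>)" "\<alpha> \<^bold>\<in> ordinal_add \<alpha> \<beta>"
proof -
  have \<beta>: "ordinal \<beta>" using assms(2) by (rule limit_ordinal_is_ordinal)
  have "nul \<^bold>\<in> \<beta>"
    using ordinal_linear[OF \<beta> ordinal_nul] limit_ordinal_neq_nul[OF assms(2)] by simp
  then show mem: "\<alpha> \<^bold>\<in> ordinal_add \<alpha> \<beta>"
    using ordinal_add_nul[OF assms(1)] unfolding mem_ordinal_add[OF \<beta>] by metis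
  have "osucc \<delta> \<^bold>\<in> ordinal_add \<alpha> \<beta>" if "\<delta> \<^bold>\<in> ordinal_add \<alpha> \<beta>" for \<delta>
    using that[unfolded mem_ordinal_add[OF \<beta>]]
  proof
    assume "\<delta> \<^bold>\<in> \<alpha>"
    then have "osucc \<delta> \<^bold>\<in> osucc \<alpha>" by (rule osucc_mem_osucc[OF assms(1)])
    then show ?thesis using mem unfolding mem_osucc mem_ordinal_add[OF \<beta>] by blast
  next
    assume "\<exists>\<gamma>. \<gamma> \<^bold>\<in> \<beta> \<and> \<delta> = ordinal_add \<alpha> \<gamma>"
    then obtain \<gamma> where \<gamma>: "\<gamma> \<^bold>\<in> \<beta>" "\<delta> = ordinal_add \<alpha> \<gamma>" by blast
    then have "osucc \<delta> = ordinal_add \<alpha> (osucc \<gamma>)"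
      using ordinal_add_osucc ordinal_mem[OF \<beta>] by metis
    then show ?thesis
      using limit_ordinal_osucc[OF assms(2) \<gamma>(1)] unfolding mem_ordinal_add[OF \<beta>] by blast
  qed
  then show "limit_ordinal (ordinal_add \<alpha> \<beta>)"
    using ordinal_ordinal_add[OF assms(1) \<beta>] mem unfolding limit_ordinal_def by auto
qed

lemma limit_ordinal_exists: "\<exists>\<omega>::'v::zfa. limit_ordinal \<omega>"
proof -
  obtain s :: 'v where s: "nul \<^bold>\<in> s"
    "\<And>x. x \<^bold>\<in> s \<Longrightarrow> \<exists>y. y \<^bold>\<in> s \<and> (\<forall>z. z \<^bold>\<in> y \<longleftrightarrow> z \<^bold>\<in> x \<or> z = x)"
    using infinity by blast
  have s_osucc: "osucc x \<^bold>\<in> s" if x: "x \<^bold>\<in> s" for x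
  proof -
    obtain y where y: "y \<^bold>\<in> s" "\<And>z. z \<^bold>\<in> y \<longleftrightarrow> z \<^bold>\<in> osucc x" using s(2)[OF x] by auto
    then have "is_set y" using is_setI[of x y] by simp
    then have "y = osucc x" by (rule set_eqI) (simp_all add: y(2))
    then show ?thesis using y(1) by simp
  qed
  have "small (\<lambda>n. n \<^bold>\<in> s \<and> ordinal n)"
    by (rule small_separation[OF small_mem]) (intro definable_intros)
  then obtain u where u: "\<And>n. n \<^bold>\<in> u \<longleftrightarrow> n \<^bold>\<in> s \<and> ordinal n" by (rule smallE) blast
  have "ordinal (big_union u)" by (rule ordinal_big_union) (simp add: u)
  moreover have "nul \<^bold>\<in> big_union u"
    unfolding mem_big_union u using s_osucc[OF s(1)] by (intro exI[of _ "osucc nul"]) simp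
  then have "big_union u \<noteq> nul" by (metis not_mem_nul)
  moreover have "osucc m \<^bold>\<in> big_union u" if "m \<^bold>\<in> big_union u" for m
    using that s_osucc osucc_mem_osucc ordinal_osucc unfolding mem_big_union u by blast
  ultimately show ?thesis unfolding limit_ordinal_def by blast
qed

lemma ordinals_bounded_by_limit:
  assumes "\<And>\<beta>. \<beta> \<^bold>\<in> u \<Longrightarrow> ordinal \<beta>"
  obtains \<gamma> where "limit_ordinal \<gamma>" "\<And>\<beta>. \<beta> \<^bold>\<in> u \<Longrightarrow> \<beta> \<^bold>\<in> \<gamma>"
proof -
  define \<sigma> where "\<sigma> = big_union u"
  have "ordinal \<sigma>" unfolding \<sigma>_def by (rule ordinal_big_union) (rule assms)
  moreover obtain \<omega> :: 'a where "limit_ordinal \<omega>" using limit_ordinal_exists by blast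
  ultimately have lim: "limit_ordinal (ordinal_add \<sigma> \<omega>)" "\<sigma> \<^bold>\<in> ordinal_add \<sigma> \<omega>"
    by (rule limit_ordinal_add)+
  have "\<beta> \<^bold>\<in> ordinal_add \<sigma> \<omega>" if "\<beta> \<^bold>\<in> u" for \<beta>
  proof -
    have "\<not> \<sigma> \<^bold>\<in> \<beta>" using mem_big_union[of \<sigma> u] that unfolding \<sigma>_def by auto
    then have "\<beta> \<^bold>\<in> \<sigma> \<or> \<beta> = \<sigma>" using ordinal_linear[OF assms[OF that] \<open>ordinal \<sigma>\<close>] by blast
    then show ?thesis using lim ordinal_trans[OF limit_ordinal_is_ordinal] by blast
  qed
  then show thesis using that lim(1) by blast
qed

lemma ordinal_collection:
  assumes definable_P: "definable_rel P" and ex: "\<And>x. x \<^bold>\<in> u \<Longrightarrow> \<exists>\<beta>. ordinal \<beta> \<and> P x \<beta>"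
  shows "\<exists>\<gamma>. limit_ordinal \<gamma> \<and> (\<forall>x. x \<^bold>\<in> u \<longrightarrow> (\<exists>\<beta>. \<beta> \<^bold>\<in> \<gamma> \<and> P x \<beta>))"
proof -
  let ?least = "\<lambda>x \<beta>. ordinal \<beta> \<and> P x \<beta> \<and> (\<forall>\<gamma>. \<gamma> \<^bold>\<in> \<beta> \<longrightarrow> \<not> P x \<gamma>)"
  have "small (\<lambda>\<beta>. \<exists>x. x \<^bold>\<in> u \<and> ?least x \<beta>)"
  proof (rule small_replacement)
    show "definable_rel ?least"
      by (intro definable_intros definable_rel_comp[OF definable_P])
    show "\<beta> = \<gamma>" if "?least x \<beta>" "?least x \<gamma>" for x \<beta> \<gamma>
      using that ordinal_linear[of \<beta> \<gamma>] by blast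
  qed
  then obtain v where v: "\<And>\<beta>. \<beta> \<^bold>\<in> v \<longleftrightarrow> (\<exists>x. x \<^bold>\<in> u \<and> ?least x \<beta>)" by (rule smallE) blast
  then obtain \<gamma> where \<gamma>: "limit_ordinal \<gamma>" "\<And>\<beta>. \<beta> \<^bold>\<in> v \<Longrightarrow> \<beta> \<^bold>\<in> \<gamma>"
    using ordinals_bounded_by_limit[of v] by blast
  have "\<exists>\<beta>. \<beta> \<^bold>\<in> \<gamma> \<and> P x \<beta>" if x: "x \<^bold>\<in> u" for x
  proof -
    obtain \<alpha> where \<alpha>: "ordinal \<alpha>" "P x \<alpha>" using ex[OF x] by blast
    have "definable_class (P x)" by (intro definable_rel_comp[OF definable_P] definable_intros)
    then obtain \<beta> where "ordinal \<beta>" "P x \<beta>" "\<And>\<gamma>. \<gamma> \<^bold>\<in> \<beta> \<Longrightarrow> \<not> P x \<gamma>"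
      using \<alpha> by (rule ordinal_least) blast
    then have "\<beta> \<^bold>\<in> v" unfolding v using x by blast
    then show ?thesis using \<gamma>(2) \<open>P x \<beta>\<close> by blast
  qed
  then show ?thesis using \<gamma>(1) by blast
qed

section \<open>The magmatic hierarchy\<close>

lemma mem_magma_base:
  "x \<^bold>\<in> magma_base R \<longleftrightarrow> x \<^bold>\<subseteq> atoms \<and> x \<noteq> nul \<and>
     (\<forall>a b. a \<^bold>\<in> x \<longrightarrow> b \<^bold>\<in> atoms \<longrightarrow> atom_le R b a \<longrightarrow> b \<^bold>\<in> x)"
proof -
  have "small (\<lambda>x. x \<^bold>\<subseteq> atoms \<and> x \<noteq> nul \<and>
      (\<forall>a b. a \<^bold>\<in> x \<longrightarrow> b \<^bold>\<in> atoms \<longrightarrow> atom_le R b a \<longrightarrow> b \<^bold>\<in> x))"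
    by (rule small_separation[OF small_subset_of]) (intro definable_intros)
  then show ?thesis unfolding magma_base_def by (rule mem_the_set)
qed

lemma
  shows is_set_magma_next: "is_set (magma_next m)"
    and mem_magma_next: "x \<^bold>\<in> magma_next m \<longleftrightarrow> x \<^bold>\<subseteq> m \<and> x \<noteq> nul \<and>
      (\<forall>y z. y \<^bold>\<in> x \<longrightarrow> z \<^bold>\<in> m \<longrightarrow> z \<^bold>\<subseteq> y \<longrightarrow> z \<^bold>\<in> x)"
proof -
  have "small (\<lambda>x. x \<^bold>\<subseteq> m \<and> x \<noteq> nul \<and> (\<forall>y z. y \<^bold>\<in> x \<longrightarrow> z \<^bold>\<in> m \<longrightarrow> z \<^bold>\<subseteq> y \<longrightarrow> z \<^bold>\<in> x))"
    by (rule small_separation[OF small_subset_of]) (intro definable_intros)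
  then show "is_set (magma_next m)"
    "x \<^bold>\<in> magma_next m \<longleftrightarrow> x \<^bold>\<subseteq> m \<and> x \<noteq> nul \<and>
      (\<forall>y z. y \<^bold>\<in> x \<longrightarrow> z \<^bold>\<in> m \<longrightarrow> z \<^bold>\<subseteq> y \<longrightarrow> z \<^bold>\<in> x)"
    unfolding magma_next_def by (simp_all add: is_set_the_set mem_the_set)
qed

lemma definable_magma_next [definable_intros]:
  "definable_term F \<Longrightarrow> definable_term (\<lambda>e. magma_next (F e))"
  by (rule definable_fun_comp[where H = magma_next])
    (unfold magma_next_def, intro definable_intros)

definition magma_step :: "'v::zfa \<Rightarrow> 'v \<Rightarrow> 'v \<Rightarrow> 'v" where
  "magma_step R \<alpha> f =
     (if \<alpha> = osucc nul then magma_base R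
      else if limit_ordinal \<alpha> then the_set (\<lambda>x. \<exists>\<beta> m. \<beta> \<noteq> nul \<and> kpair \<beta> m \<^bold>\<in> f \<and> x \<^bold>\<in> m)
      else the_set (\<lambda>x. \<exists>\<beta> m. \<alpha> = osucc \<beta> \<and> kpair \<beta> m \<^bold>\<in> f \<and> x \<^bold>\<in> magma_next m))"

definition magma_hierarchy :: "'v::zfa \<Rightarrow> 'v \<Rightarrow> 'v" where
  "magma_hierarchy R = ordinal_rec (magma_step R)"

lemma definable_magma_step: "definable_fun2 (magma_step R)"
  unfolding magma_step_def by (intro definable_intros)

lemma definable_magma_hierarchy [definable_intros]:
  "definable_term F \<Longrightarrow> definable_term (\<lambda>e. magma_hierarchy R (F e))"
  unfolding magma_hierarchy_def by (rule definable_ordinal_rec[OF definable_magma_step])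

lemma magma_hierarchy_unfold:
  assumes "ordinal \<alpha>"
  shows "magma_hierarchy R \<alpha> =
     (if \<alpha> = osucc nul then magma_base R
      else if limit_ordinal \<alpha> then
        the_set (\<lambda>x. \<exists>\<beta>. \<beta> \<^bold>\<in> \<alpha> \<and> \<beta> \<noteq> nul \<and> x \<^bold>\<in> magma_hierarchy R \<beta>)
      else the_set (\<lambda>x. \<exists>\<beta>. \<alpha> = osucc \<beta> \<and> x \<^bold>\<in> magma_next (magma_hierarchy R \<beta>)))"
proof -
  have graph: "kpair \<beta> m \<^bold>\<in> graph_on (magma_hierarchy R) \<alpha> \<longleftrightarrow>
      \<beta> \<^bold>\<in> \<alpha> \<and> m = magma_hierarchy R \<beta>" for \<beta> m
    by (intro kpair_mem_graph_on definable_intros)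
  have "magma_hierarchy R \<alpha> = magma_step R \<alpha> (graph_on (magma_hierarchy R) \<alpha>)"
    unfolding magma_hierarchy_def by (rule ordinal_rec_unfold[OF definable_magma_step assms])
  also have "\<dots> = (if \<alpha> = osucc nul then magma_base R
      else if limit_ordinal \<alpha> then
        the_set (\<lambda>x. \<exists>\<beta>. \<beta> \<^bold>\<in> \<alpha> \<and> \<beta> \<noteq> nul \<and> x \<^bold>\<in> magma_hierarchy R \<beta>)
      else the_set (\<lambda>x. \<exists>\<beta>. \<alpha> = osucc \<beta> \<and> x \<^bold>\<in> magma_next (magma_hierarchy R \<beta>)))"
    unfolding magma_step_def graph by (intro if_cong arg_cong[of _ _ the_set]) auto
  finally show ?thesis .
qed

lemma magma_hierarchy_nul: "magma_hierarchy R nul = nul"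
  using magma_hierarchy_unfold[OF ordinal_nul, of R] limit_ordinal_neq_nul
  by (auto simp: the_set_False osucc_neq_nul[symmetric])

lemma magma_hierarchy_one: "magma_hierarchy R (osucc nul) = magma_base R"
  by (simp add: magma_hierarchy_unfold)

lemma magma_hierarchy_osucc:
  assumes "ordinal \<alpha>" "\<alpha> \<noteq> nul"
  shows "magma_hierarchy R (osucc \<alpha>) = magma_next (magma_hierarchy R \<alpha>)"
  using assms by (simp add: magma_hierarchy_unfold the_set_mem is_set_magma_next)

lemma magma_hierarchy_limit:
  assumes "limit_ordinal \<gamma>"
  shows "magma_hierarchy R \<gamma> = the_set (\<lambda>x. \<exists>\<beta>. \<beta> \<^bold>\<in> \<gamma> \<and> \<beta> \<noteq> nul \<and> x \<^bold>\<in> magma_hierarchy R \<beta>)"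
proof -
  have "\<gamma> \<noteq> osucc nul" using assms not_limit_osucc by blast
  then show ?thesis
    using magma_hierarchy_unfold[OF limit_ordinal_is_ordinal[OF assms]] assms by simp
qed

lemma mem_magma_hierarchyD:
  assumes "x \<^bold>\<in> magma_hierarchy R \<alpha>"
  shows "ordinal \<alpha>" "\<alpha> \<noteq> nul"
proof -
  show "ordinal \<alpha>"
    using assms unfolding magma_hierarchy_def ordinal_rec_def by (cases "ordinal \<alpha>") simp_all
  show "\<alpha> \<noteq> nul" using assms magma_hierarchy_nul[of R] by auto
qed

lemma mem_magma_hierarchy_limit:
  assumes "limit_ordinal \<gamma>"
  shows "x \<^bold>\<in> magma_hierarchy R \<gamma> \<longleftrightarrow> (\<exists>\<beta>. \<beta> \<^bold>\<in> \<gamma> \<and> x \<^bold>\<in> magma_hierarchy R \<beta>)"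
proof -
  have "small (\<lambda>x. \<exists>\<beta>. \<beta> \<^bold>\<in> \<gamma> \<and> x \<^bold>\<in> magma_hierarchy R \<beta>)"
    by (intro small_UN definable_intros)
  moreover have "(\<lambda>x. \<exists>\<beta>. \<beta> \<^bold>\<in> \<gamma> \<and> \<beta> \<noteq> nul \<and> x \<^bold>\<in> magma_hierarchy R \<beta>) =
      (\<lambda>x. \<exists>\<beta>. \<beta> \<^bold>\<in> \<gamma> \<and> x \<^bold>\<in> magma_hierarchy R \<beta>)"
    using mem_magma_hierarchyD(2) by blast
  ultimately show ?thesis unfolding magma_hierarchy_limit[OF assms] by (simp add: mem_the_set)
qed

lemma magma_seq_kpair_mem_iff:
  assumes "magma_seq R \<alpha> f" "\<beta> \<^bold>\<in> osucc \<alpha>" "\<beta> \<noteq> nul"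
  shows "kpair \<beta> m \<^bold>\<in> f \<longleftrightarrow> m = app f \<beta>"
proof -
  have "\<exists>!m. kpair \<beta> m \<^bold>\<in> f" using assms unfolding magma_seq_def by blast
  then show ?thesis unfolding app_def by (metis (mono_tags, lifting) theI')
qed

lemma magma_seq_app_step:
  assumes f: "magma_seq R \<alpha> f" and "ordinal \<beta>" and \<beta>: "\<beta> \<^bold>\<in> osucc \<alpha>" "\<beta> \<noteq> nul"
    and IH: "\<And>\<delta>. \<delta> \<^bold>\<in> \<beta> \<Longrightarrow> \<delta> \<noteq> nul \<Longrightarrow> app f \<delta> = magma_hierarchy R \<delta>"
  shows "app f \<beta> = magma_hierarchy R \<beta>"
  using assms(2)
proof (cases rule: ordinal_cases)
  case (osucc \<gamma>)
  show ?thesis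
  proof (cases "\<gamma> = nul")
    case True
    then show ?thesis
      using f \<beta>(1) osucc(2) magma_hierarchy_one unfolding magma_seq_def by metis
  next
    case False
    have "app f \<beta> = magma_next (app f \<gamma>)"
      using f False \<beta>(1) osucc(2) unfolding magma_seq_def by blast
    also have "\<dots> = magma_hierarchy R \<beta>"
      using IH[of \<gamma>] osucc(2) False magma_hierarchy_osucc[OF osucc(1) False] by simp
    finally show ?thesis .
  qed
next
  case limit
  have "app f \<beta> = the_set (\<lambda>x. \<exists>\<delta>. \<delta> \<^bold>\<in> \<beta> \<and> \<delta> \<noteq> nul \<and> x \<^bold>\<in> app f \<delta>)"
    using f limit \<beta>(1) unfolding magma_seq_def by blast
  also have "\<dots> = magma_hierarchy R \<beta>"
    unfolding magma_hierarchy_limit[OF limit] using IH by (simp cong: conj_cong)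
  finally show ?thesis .
qed (use \<beta>(2) in blast)

lemma magma_seq_app:
  assumes f: "magma_seq R \<alpha> f" and "ordinal \<alpha>" and \<beta>: "\<beta> \<^bold>\<in> osucc \<alpha>" "\<beta> \<noteq> nul"
  shows "app f \<beta> = magma_hierarchy R \<beta>"
proof -
  have \<alpha>: "ordinal (osucc \<alpha>)" using assms(2) by simp
  then have "ordinal \<beta>" using \<beta>(1) by (rule ordinal_mem)
  \<comment> \<open>The induction is over membership in \<open>f\<close>, because \<open>app\<close> need not be definable.\<close>
  then have "\<beta> \<^bold>\<in> osucc \<alpha> \<longrightarrow> \<beta> \<noteq> nul \<longrightarrow> kpair \<beta> (magma_hierarchy R \<beta>) \<^bold>\<in> f"
  proof (induction \<beta> rule: ordinal_induct)
    case definable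
    show ?case by (intro definable_intros)
  next
    case (step \<beta>)
    show ?case
    proof (intro impI)
      assume \<beta>: "\<beta> \<^bold>\<in> osucc \<alpha>" "\<beta> \<noteq> nul"
      have "app f \<delta> = magma_hierarchy R \<delta>" if "\<delta> \<^bold>\<in> \<beta>" "\<delta> \<noteq> nul" for \<delta>
        using step.IH[OF that(1)] ordinal_trans[OF \<alpha> \<beta>(1) that(1)] that(2)
          magma_seq_kpair_mem_iff[OF f] by metis
      then have "app f \<beta> = magma_hierarchy R \<beta>" by (rule magma_seq_app_step[OF f step(1) \<beta>])
      then show "kpair \<beta> (magma_hierarchy R \<beta>) \<^bold>\<in> f"
        using magma_seq_kpair_mem_iff[OF f \<beta>] by simp
    qed
  qed
  then show ?thesis using \<beta> magma_seq_kpair_mem_iff[OF f \<beta>] by metis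
qed

definition magma_hierarchy_upto :: "'v::zfa \<Rightarrow> 'v \<Rightarrow> 'v" where
  "magma_hierarchy_upto R \<alpha> =
     graph_on (magma_hierarchy R) (the_set (\<lambda>\<beta>. \<beta> \<^bold>\<in> osucc \<alpha> \<and> \<beta> \<noteq> nul))"

lemma is_relation_magma_hierarchy_upto: "is_relation (magma_hierarchy_upto R \<alpha>)"
  unfolding magma_hierarchy_upto_def by (intro is_relation_graph_on definable_intros)

lemma kpair_mem_magma_hierarchy_upto:
  "kpair \<beta> m \<^bold>\<in> magma_hierarchy_upto R \<alpha> \<longleftrightarrow>
     \<beta> \<^bold>\<in> osucc \<alpha> \<and> \<beta> \<noteq> nul \<and> m = magma_hierarchy R \<beta>"
proof -
  have "small (\<lambda>\<beta>. \<beta> \<^bold>\<in> osucc \<alpha> \<and> \<beta> \<noteq> nul)"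
    by (rule small_separation[OF small_mem]) (intro definable_intros)
  moreover have "definable_fun (magma_hierarchy R)" by (intro definable_intros)
  ultimately show ?thesis
    unfolding magma_hierarchy_upto_def by (simp add: kpair_mem_graph_on mem_the_set)
qed

lemma app_magma_hierarchy_upto:
  "\<beta> \<^bold>\<in> osucc \<alpha> \<Longrightarrow> \<beta> \<noteq> nul \<Longrightarrow> app (magma_hierarchy_upto R \<alpha>) \<beta> = magma_hierarchy R \<beta>"
  unfolding app_def kpair_mem_magma_hierarchy_upto by simp

lemma magma_seq_magma_hierarchy_upto:
  assumes "ordinal \<alpha>"
  shows "magma_seq R \<alpha> (magma_hierarchy_upto R \<alpha>)"
  unfolding magma_seq_def
proof (intro conjI allI impI)
  let ?f = "magma_hierarchy_upto R \<alpha>"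
  note app = app_magma_hierarchy_upto[where R = R and \<alpha> = \<alpha>]
  have \<alpha>: "ordinal (osucc \<alpha>)" using assms by simp
  show "is_set ?f" using is_relation_magma_hierarchy_upto unfolding is_relation_def by blast
  show "\<exists>\<beta> m. \<beta> \<^bold>\<in> osucc \<alpha> \<and> \<beta> \<noteq> nul \<and> p = kpair \<beta> m" if "p \<^bold>\<in> ?f" for p
    using is_relation_magma_hierarchy_upto that kpair_mem_magma_hierarchy_upto
    unfolding is_relation_def by metis
  show "\<exists>!m. kpair \<beta> m \<^bold>\<in> ?f" if "\<beta> \<^bold>\<in> osucc \<alpha> \<and> \<beta> \<noteq> nul" for \<beta>
    using that unfolding kpair_mem_magma_hierarchy_upto by blast
  show "app ?f (osucc nul) = magma_base R" if "osucc nul \<^bold>\<in> osucc \<alpha>"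
    using app[OF that] magma_hierarchy_one by simp
  show "app ?f (osucc \<beta>) = magma_next (app ?f \<beta>)" if "\<beta> \<noteq> nul \<and> osucc \<beta> \<^bold>\<in> osucc \<alpha>" for \<beta>
  proof -
    have "\<beta> \<^bold>\<in> osucc \<alpha>" "ordinal \<beta>"
      using that ordinal_trans[OF \<alpha>, of "osucc \<beta>" \<beta>] ordinal_mem[OF \<alpha>] by simp_all
    then show ?thesis using app that magma_hierarchy_osucc[of \<beta> R] by simp
  qed
  show "app ?f \<gamma> = the_set (\<lambda>x. \<exists>\<beta>. \<beta> \<^bold>\<in> \<gamma> \<and> \<beta> \<noteq> nul \<and> x \<^bold>\<in> app ?f \<beta>)"
    if \<gamma>: "limit_ordinal \<gamma> \<and> \<gamma> \<^bold>\<in> osucc \<alpha>" for \<gamma>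
  proof -
    have "app ?f \<beta> = magma_hierarchy R \<beta>" if "\<beta> \<^bold>\<in> \<gamma>" "\<beta> \<noteq> nul" for \<beta>
      using app ordinal_trans[OF \<alpha> _ that(1)] \<gamma> that(2) by blast
    moreover have "app ?f \<gamma> = magma_hierarchy R \<gamma>" using app \<gamma> limit_ordinal_neq_nul by blast
    ultimately show ?thesis using \<gamma> magma_hierarchy_limit[of \<gamma> R] by (simp cong: conj_cong)
  qed
qed

lemma magma_seq_unique:
  assumes "ordinal \<alpha>" "magma_seq R \<alpha> f" "magma_seq R \<alpha> g"
  shows "f = g"
proof (rule set_eqI)
  show "is_set f" "is_set g" using assms(2,3) unfolding magma_seq_def by blast+
  have "p \<^bold>\<in> g" if f: "magma_seq R \<alpha> f" and g: "magma_seq R \<alpha> g" and "p \<^bold>\<in> f" for p f g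
  proof -
    obtain \<beta> m where p: "p = kpair \<beta> m" and \<beta>: "\<beta> \<^bold>\<in> osucc \<alpha>" "\<beta> \<noteq> nul"
      using f \<open>p \<^bold>\<in> f\<close> unfolding magma_seq_def by blast
    have "app f \<beta> = app g \<beta>"
      using magma_seq_app[OF f assms(1) \<beta>] magma_seq_app[OF g assms(1) \<beta>] by simp
    then show ?thesis
      using \<open>p \<^bold>\<in> f\<close> magma_seq_kpair_mem_iff[OF f \<beta>] magma_seq_kpair_mem_iff[OF g \<beta>]
      unfolding p by simp
  qed
  then show "p \<^bold>\<in> f \<longleftrightarrow> p \<^bold>\<in> g" for p using assms(2,3) by blast
qed

lemma magma_level_eq:
  assumes "ordinal \<alpha>" "\<alpha> \<noteq> nul"
  shows "magma_level R \<alpha> = magma_hierarchy R \<alpha>"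
proof -
  obtain f where f: "magma_seq R \<alpha> f" using magma_seq_magma_hierarchy_upto[OF assms(1)] by blast
  then have "(THE f. magma_seq R \<alpha> f) = f"
    using magma_seq_unique[OF assms(1) _ f] by (rule the_equality)
  then show ?thesis
    unfolding magma_level_def using magma_seq_app[OF f assms(1) _ assms(2)] by simp
qed

lemma magmas_iff: "x \<in> magmas R \<longleftrightarrow> (\<exists>\<alpha>. x \<^bold>\<in> magma_hierarchy R \<alpha>)"
proof -
  have "ordinal \<alpha> \<and> \<alpha> \<noteq> nul \<and> x \<^bold>\<in> magma_level R \<alpha> \<longleftrightarrow> x \<^bold>\<in> magma_hierarchy R \<alpha>" for \<alpha>
    using magma_level_eq[of \<alpha> R] mem_magma_hierarchyD[of x R \<alpha>] by auto
  then show ?thesis unfolding magmas_def by simp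
qed

lemma definable_magmas [definable_intros]:
  "definable_term F \<Longrightarrow> definable (\<lambda>e. F e \<in> magmas R)"
  unfolding magmas_iff
  by (rule definable_class_comp[where P = "\<lambda>x. \<exists>\<alpha>. x \<^bold>\<in> magma_hierarchy R \<alpha>"])
    (intro definable_intros)

lemma magma_is_set:
  assumes "x \<in> magmas R"
  shows "is_set x"
proof -
  obtain \<alpha> where \<alpha>: "x \<^bold>\<in> magma_hierarchy R \<alpha>" using assms unfolding magmas_iff by blast
  from mem_magma_hierarchyD(1)[OF this] \<alpha> show ?thesis
  proof (induction \<alpha> rule: ordinal_induct)
    case definable
    show ?case by (intro definable_intros)
  next
    case (step \<alpha>)
    from step(1) show ?case
    proof (cases rule: ordinal_cases)
      case nul
      then show ?thesis using mem_magma_hierarchyD(2)[OF step.prems] by blast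
    next
      case (osucc \<beta>)
      then have "x \<^bold>\<in> magma_base R \<or> x \<^bold>\<in> magma_next (magma_hierarchy R \<beta>)"
        using step.prems magma_hierarchy_one[of R] magma_hierarchy_osucc[of \<beta> R]
        by (cases "\<beta> = nul") auto
      then show ?thesis unfolding mem_magma_base mem_magma_next subset_of_def by blast
    next
      case limit
      then show ?thesis
        using step.prems step.IH unfolding mem_magma_hierarchy_limit[OF limit] by blast
    qed
  qed
qed

lemma magma_not_atom: "x \<in> magmas R \<Longrightarrow> \<not> x \<^bold>\<in> atoms"
  using magma_is_set unfolding is_set_def by blast

definition magma_downset :: "'v::zfa \<Rightarrow> 'v \<Rightarrow> bool" where
  "magma_downset R u \<longleftrightarrow> is_set u \<and>
     (\<forall>x. x \<^bold>\<in> u \<longrightarrow> x \<in> magmas R \<and> (\<forall>y. y \<in> magmas R \<longrightarrow> y \<^bold>\<subseteq> x \<longrightarrow> y \<^bold>\<in> u))"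

lemma magma_downset_un:
  "magma_downset R u \<Longrightarrow> magma_downset R v \<Longrightarrow> magma_downset R (u \<^bold>\<union> v)"
  unfolding magma_downset_def mem_un using is_set_un by blast

theorem nonempty_magma_downset_is_magma:
  assumes u: "magma_downset R u" and "u \<noteq> nul"
  shows "u \<in> magmas R"
proof -
  have magmas: "x \<in> magmas R" if "x \<^bold>\<in> u" for x
    using u that unfolding magma_downset_def by blast
  have "definable_rel (\<lambda>x \<alpha>. x \<^bold>\<in> magma_hierarchy R \<alpha>)" by (intro definable_intros)
  moreover have "\<exists>\<alpha>. ordinal \<alpha> \<and> x \<^bold>\<in> magma_hierarchy R \<alpha>" if "x \<^bold>\<in> u" for x
    using magmas[OF that] mem_magma_hierarchyD(1) unfolding magmas_iff by blast
  ultimately have "\<exists>\<gamma>. limit_ordinal \<gamma> \<and>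
      (\<forall>x. x \<^bold>\<in> u \<longrightarrow> (\<exists>\<alpha>. \<alpha> \<^bold>\<in> \<gamma> \<and> x \<^bold>\<in> magma_hierarchy R \<alpha>))"
    by (rule ordinal_collection)
  then obtain \<gamma> where \<gamma>: "limit_ordinal \<gamma>"
    and level: "\<forall>x. x \<^bold>\<in> u \<longrightarrow> (\<exists>\<alpha>. \<alpha> \<^bold>\<in> \<gamma> \<and> x \<^bold>\<in> magma_hierarchy R \<alpha>)"
    by blast
  have "x \<^bold>\<in> magma_hierarchy R \<gamma>" if "x \<^bold>\<in> u" for x
    using level that unfolding mem_magma_hierarchy_limit[OF \<gamma>] by blast
  moreover have "is_set u" using u unfolding magma_downset_def by blast
  moreover obtain x where "x \<^bold>\<in> u" using \<open>is_set u\<close> assms(2) set_eqI[OF _ is_set_nul] by auto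
  ultimately have "u \<^bold>\<subseteq> magma_hierarchy R \<gamma>"
    using is_setI[of x] unfolding subset_of_def by blast
  moreover have "y \<^bold>\<in> u" if "x \<^bold>\<in> u" "y \<^bold>\<in> magma_hierarchy R \<gamma>" "y \<^bold>\<subseteq> x" for x y
    using u that magmas_iff unfolding magma_downset_def by blast
  ultimately have "u \<^bold>\<in> magma_next (magma_hierarchy R \<gamma>)"
    unfolding mem_magma_next using assms(2) by blast
  then have "u \<^bold>\<in> magma_hierarchy R (osucc \<gamma>)"
    unfolding magma_hierarchy_osucc[OF \<gamma>[THEN limit_ordinal_is_ordinal]
        \<gamma>[THEN limit_ordinal_neq_nul]] .
  then show ?thesis unfolding magmas_iff by blast
qed

section \<open>Predecessor sets and the magmatic pair\<close>

lemma
  assumes "is_set x"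
  shows is_set_pr: "is_set (pr R x)"
    and mem_pr: "z \<^bold>\<in> pr R x \<longleftrightarrow> z \<in> magmas R \<and> z \<^bold>\<subseteq> x"
proof -
  have "small (\<lambda>z. z \<^bold>\<subseteq> x \<and> z \<in> magmas R)"
    by (rule small_separation[OF small_subset_of]) (intro definable_intros)
  then have "small (\<lambda>z. z \<in> magmas R \<and> z \<^bold>\<subseteq> x)" by (simp only: conj_commute)
  moreover have "pr R x = the_set (\<lambda>z. z \<in> magmas R \<and> z \<^bold>\<subseteq> x)"
    using assms unfolding pr_def is_set_def by simp
  ultimately show "is_set (pr R x)" "z \<^bold>\<in> pr R x \<longleftrightarrow> z \<in> magmas R \<and> z \<^bold>\<subseteq> x"
    by (simp_all add: is_set_the_set mem_the_set)
qed

lemma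
  assumes "a \<^bold>\<in> atoms"
  shows is_set_pr_atom: "is_set (pr R a)"
    and mem_pr_atom: "b \<^bold>\<in> pr R a \<longleftrightarrow> b \<^bold>\<in> atoms \<and> atom_le R b a"
proof -
  have "small (\<lambda>b. b \<^bold>\<in> atoms \<and> atom_le R b a)"
    by (rule small_separation[OF small_mem]) (intro definable_intros)
  moreover have "pr R a = the_set (\<lambda>b. b \<^bold>\<in> atoms \<and> atom_le R b a)"
    using assms unfolding pr_def by simp
  ultimately show "is_set (pr R a)" "b \<^bold>\<in> pr R a \<longleftrightarrow> b \<^bold>\<in> atoms \<and> atom_le R b a"
    by (simp_all add: is_set_the_set mem_the_set)
qed

lemma mem_pr_magma: "x \<in> magmas R \<Longrightarrow> z \<^bold>\<in> pr R x \<longleftrightarrow> z \<in> magmas R \<and> z \<^bold>\<subseteq> x"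
  using mem_pr magma_is_set by blast

lemma mem_pr_self: "x \<in> magmas R \<Longrightarrow> x \<^bold>\<in> pr R x"
  using mem_pr_magma magma_is_set subset_of_refl by blast

lemma magma_downset_pr:
  assumes "x \<in> magmas R"
  shows "magma_downset R (pr R x)"
  unfolding magma_downset_def mem_pr_magma[OF assms]
  using is_set_pr[OF magma_is_set[OF assms]] subset_of_trans by blast

lemma pr_magma:
  assumes "x \<in> magmas R"
  shows "pr R x \<in> magmas R"
  using magma_downset_pr[OF assms]
proof (rule nonempty_magma_downset_is_magma)
  show "pr R x \<noteq> nul" using mem_pr_self[OF assms] by auto
qed

lemma pr_un_pr_magma:
  assumes "x \<in> magmas R" "y \<in> magmas R"
  shows "pr R x \<^bold>\<union> pr R y \<in> magmas R"
  using magma_downset_un[OF assms[THEN magma_downset_pr]]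
proof (rule nonempty_magma_downset_is_magma)
  show "pr R x \<^bold>\<union> pr R y \<noteq> nul" using mem_pr_self[OF assms(1)] mem_un not_mem_nul by metis
qed

lemma mem_pr_atom_self: "preorder_on_atoms R \<Longrightarrow> a \<^bold>\<in> atoms \<Longrightarrow> a \<^bold>\<in> pr R a"
  unfolding mem_pr_atom preorder_on_atoms_def by blast

lemma pr_atom_magma:
  assumes "preorder_on_atoms R" "a \<^bold>\<in> atoms"
  shows "pr R a \<in> magmas R"
proof -
  have "pr R a \<^bold>\<in> magma_base R"
    unfolding mem_magma_base
  proof (intro conjI allI impI)
    show "pr R a \<^bold>\<subseteq> atoms"
      using assms(2) is_setI is_set_pr_atom
      unfolding subset_of_def mem_pr_atom[OF assms(2)] by blast
    show "pr R a \<noteq> nul" using mem_pr_atom_self[OF assms] by auto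
    show "c \<^bold>\<in> pr R a" if "b \<^bold>\<in> pr R a" "c \<^bold>\<in> atoms" "atom_le R c b" for b c
      using that assms(1) unfolding mem_pr_atom[OF assms(2)] preorder_on_atoms_def by blast
  qed
  then have "pr R a \<^bold>\<in> magma_hierarchy R (osucc nul)" unfolding magma_hierarchy_one .
  then show ?thesis unfolding magmas_iff by blast
qed

definition magma_tag :: "'v::zfa \<Rightarrow> 'v \<Rightarrow> 'v \<Rightarrow> 'v" where
  "magma_tag R a x = pr R (pr R x) \<^bold>\<union> pr R (pr R a)"

lemma magma_tag_magma:
  assumes "preorder_on_atoms R" "a \<^bold>\<in> atoms" "x \<in> magmas R"
  shows "magma_tag R a x \<in> magmas R"
  unfolding magma_tag_def using assms by (intro pr_un_pr_magma pr_magma pr_atom_magma)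

lemma mem_magma_tag:
  assumes "preorder_on_atoms R" "a \<^bold>\<in> atoms" "x \<in> magmas R"
  shows "z \<^bold>\<in> magma_tag R a x \<longleftrightarrow> z \<in> magmas R \<and> (z \<^bold>\<subseteq> pr R x \<or> z \<^bold>\<subseteq> pr R a)"
  using mem_pr_magma[OF pr_magma[OF assms(3)]] mem_pr_magma[OF pr_atom_magma[OF assms(1,2)]]
  unfolding magma_tag_def by auto

lemma magma_tag_not_subset:
  assumes R: "preorder_on_atoms R" and a: "a \<^bold>\<in> atoms" and b: "b \<^bold>\<in> atoms"
    and "\<not> atom_le R a b" and x: "x \<in> magmas R" and y: "y \<in> magmas R"
  shows "\<not> magma_tag R a x \<^bold>\<subseteq> magma_tag R b y"
proof
  assume "magma_tag R a x \<^bold>\<subseteq> magma_tag R b y"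
  moreover have "pr R a \<^bold>\<in> magma_tag R a x"
    using pr_atom_magma[OF R a] subset_of_refl[OF is_set_pr_atom[OF a]]
    unfolding mem_magma_tag[OF R a x] by blast
  ultimately have "pr R a \<^bold>\<in> magma_tag R b y" by (rule subset_ofD)
  then have "a \<^bold>\<in> pr R y \<or> a \<^bold>\<in> pr R b"
    using mem_pr_atom_self[OF R a] subset_ofD unfolding mem_magma_tag[OF R b y] by blast
  then show False
    using a magma_not_atom assms(4) unfolding mem_pr_magma[OF y] mem_pr_atom[OF b] by blast
qed

lemma magma_tag_subset_imp_subset:
  assumes R: "preorder_on_atoms R" and a: "a \<^bold>\<in> atoms"
    and x: "x \<in> magmas R" and y: "y \<in> magmas R"
    and "magma_tag R a x \<^bold>\<subseteq> magma_tag R a y"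
  shows "x \<^bold>\<subseteq> y"
proof -
  have "pr R x \<^bold>\<in> magma_tag R a x"
    using pr_magma[OF x] subset_of_refl[OF magma_is_set[OF pr_magma[OF x]]]
    unfolding mem_magma_tag[OF R a x] by blast
  with assms(5) have "pr R x \<^bold>\<in> magma_tag R a y" by (rule subset_ofD)
  then have "x \<^bold>\<in> pr R y \<or> x \<^bold>\<in> pr R a"
    using mem_pr_self[OF x] subset_ofD unfolding mem_magma_tag[OF R a y] by blast
  then show ?thesis
    using magma_not_atom[OF x] unfolding mem_pr_magma[OF y] mem_pr_atom[OF a] by blast
qed

lemma mem_magma_pair:
  assumes "preorder_on_atoms R" "a \<^bold>\<in> atoms" "b \<^bold>\<in> atoms" "x \<in> magmas R" "y \<in> magmas R"
  shows "z \<^bold>\<in> magma_pair R a b x y \<longleftrightarrow>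
    z \<in> magmas R \<and> (z \<^bold>\<subseteq> magma_tag R a x \<or> z \<^bold>\<subseteq> magma_tag R b y)"
  using mem_pr_magma[OF magma_tag_magma[OF assms(1,2,4)]]
    mem_pr_magma[OF magma_tag_magma[OF assms(1,3,5)]]
  unfolding magma_pair_def magma_tag_def by auto

lemma magma_pair_eq_imp_subset:
  assumes R: "preorder_on_atoms R" and a: "a \<^bold>\<in> atoms" "b \<^bold>\<in> atoms"
    and incomparable: "\<not> atom_le R a b" "\<not> atom_le R b a"
    and magmas: "x \<in> magmas R" "y \<in> magmas R" "x' \<in> magmas R" "y' \<in> magmas R"
    and pairs_eq: "magma_pair R a b x y = magma_pair R a b x' y'"
  shows "x \<^bold>\<subseteq> x' \<and> y \<^bold>\<subseteq> y'"
proof -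
  have tags: "magma_tag R a x \<in> magmas R" "magma_tag R b y \<in> magmas R"
    using magma_tag_magma R a magmas by blast+
  have "magma_tag R a x \<^bold>\<in> magma_pair R a b x y" "magma_tag R b y \<^bold>\<in> magma_pair R a b x y"
    using tags subset_of_refl[OF magma_is_set]
    unfolding mem_magma_pair[OF R a magmas(1,2)] by blast+
  then have "magma_tag R a x \<^bold>\<subseteq> magma_tag R a x'" "magma_tag R b y \<^bold>\<subseteq> magma_tag R b y'"
    using magma_tag_not_subset[OF R] a incomparable magmas
    unfolding pairs_eq mem_magma_pair[OF R a magmas(3,4)] by blast+
  then show ?thesis using magma_tag_subset_imp_subset[OF R] a magmas by blast
qed

theorem theorem3p4:
  fixes R a0 a1 x y x' y' :: "'v::zfa"
  assumes "preorder_on_atoms R"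
    and "no_minimal_atoms R"
    and "a0 \<^bold>\<in> atoms" and "a1 \<^bold>\<in> atoms"
    and "\<not> atom_le R a0 a1" and "\<not> atom_le R a1 a0"
    and "x \<in> magmas R" and "y \<in> magmas R" and "x' \<in> magmas R" and "y' \<in> magmas R"
  shows "magma_pair R a0 a1 x y = magma_pair R a0 a1 x' y' \<longleftrightarrow> x = x' \<and> y = y'"
proof
  assume pairs_eq: "magma_pair R a0 a1 x y = magma_pair R a0 a1 x' y'"
  have "x \<^bold>\<subseteq> x' \<and> y \<^bold>\<subseteq> y'"
    by (rule magma_pair_eq_imp_subset[OF assms(1,3-6) assms(7,8,9,10) pairs_eq])
  moreover have "x' \<^bold>\<subseteq> x \<and> y' \<^bold>\<subseteq> y"
    by (rule magma_pair_eq_imp_subset[OF assms(1,3-6) assms(9,10,7,8) pairs_eq[symmetric]])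
  ultimately show "x = x' \<and> y = y'" using subset_of_antisym by blast
qed simp

end
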